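(* Let $G$ be a finitely generated free group, let $H \leq G$ be a non-trivial subgroup of infinite index, let $G$ act on a standard probability space $(X,\mu)$ by measure preserving bijections, and let $H$ act on $(X,\mu)$ by restricting the action of $G$. Suppose there are infinitely many finite index subgroups of $G$ containing $H$. If $f_H(X,\mu)$ is defined, then $f_G(X,\mu)$ is defined and $f_G(X,\mu)\leq 0$.
   Context: For a countable measurable partition $\alpha$ of $X$, $g\in G$ and finite $F\subseteq G$, put $g\cdot\alpha=\{g\cdot A : A\in\alpha\}$ and $F\cdot\alpha=\bigvee_{f\in F} f\cdot\alpha$ (join of partitions). The Shannon entropy is $\mathrm{H}(\alpha)=\sum_{A\in\alpha}-\mu(A)\log\mu(A)$. A countable measurable partition $\alpha$ is generating for an action of a group $G$ if the smallest $G$-invariant $\sigma$-algebra containing $\alpha$ contains all measurable sets up to null sets. f-invariant entropy (defined only for actions of finitely generated free groups): let $G$ be a finitely generated free group with free generating set $S$, $r=|S|$, acting measure preservingly on a standard probability space $(X,\mu)$. For $\alpha$ with $\mathrm{H}(\alpha)<\infty$ set $F_G(X,\mu,S,\alpha)=(1-2r)\mathrm{H}(\alpha)+\sum_{s\in S}\mathrm{H}(s\cdot\alpha\vee\alpha)$. Let $B_S(n)$ be the ball of radius $n$ about $1_G$ for the $S$-word length. If there is a generating partition $\alpha$ with $\mathrm{H}(\alpha)<\infty$, define $f_G(X,\mu)=\lim_{n\to\infty}F_G(X,\mu,S,B_S(n)\cdot\alpha)$; otherwise $f_G(X,\mu)$ is undefined. By theorems of Bowen the sequence is non-increasing, so the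 limit exists in $[-\infty,\infty)$, and it does not depend on the choice of $S$ or of the finite Shannon entropy generating partition $\alpha$. *)

theory Defs
  imports "HOL-Probability.Probability" "HOL-Algebra.Algebra"
begin

section \<open>Finitely generated free groups\<close>

text \<open>A letter \<open>(s, True)\<close> stands for \<open>s\<close> and \<open>(s, False)\<close> for its inverse.\<close>

definition eval_letter :: "('g, 'b) monoid_scheme \<Rightarrow> 'g \<times> bool \<Rightarrow> 'g" where
  "eval_letter G l = (if snd l then fst l else inv\<^bsub>G\<^esub> (fst l))"

definition eval_word :: "('g, 'b) monoid_scheme \<Rightarrow> ('g \<times> bool) list \<Rightarrow> 'g" where
  "eval_word G w = foldr (\<lambda>l x. eval_letter G l \<otimes>\<^bsub>G\<^esub> x) w \<one>\<^bsub>G\<^esub>"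

definition words_over :: "'g set \<Rightarrow> ('g \<times> bool) list set" where
  "words_over S = {w. fst ` set w \<subseteq> S}"

definition reduced :: "('g \<times> bool) list \<Rightarrow> bool" where
  "reduced w \<longleftrightarrow> successively (\<lambda>l m. \<not> (fst l = fst m \<and> snd l \<noteq> snd m)) w"

definition free_generating_set :: "('g, 'b) monoid_scheme \<Rightarrow> 'g set \<Rightarrow> bool" where
  "free_generating_set G S \<longleftrightarrow>
     S \<subseteq> carrier G \<and> bij_betw (eval_word G) {w \<in> words_over S. reduced w} (carrier G)"

definition fg_free_group :: "('g, 'b) monoid_scheme \<Rightarrow> bool" where
  "fg_free_group G \<longleftrightarrow> group G \<and> (\<exists>S. finite S \<and> free_generating_set G S)"

definition word_ball :: "('g, 'b) monoid_scheme \<Rightarrow> 'g set \<Rightarrow> nat \<Rightarrow> 'g set" where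
  "word_ball G S n = eval_word G ` {w \<in> words_over S. length w \<le> n}"


section \<open>Probability measure preserving actions\<close>

text \<open>The \<open>\<sigma>\<close>-algebra of \<open>M\<close> is the Borel \<open>\<sigma>\<close>-algebra of some Polish topology on \<open>space M\<close>.\<close>

definition standard_prob_space :: "'x measure \<Rightarrow> bool" where
  "standard_prob_space M \<longleftrightarrow> prob_space M \<and>
     (\<exists>T. topspace T = space M \<and> completely_metrizable_space T \<and> second_countable T \<and>
          sets M = sigma_sets (space M) {U. openin T U})"

text \<open>
  An action in the sense of \<^locale>\<open>group_action\<close> consists of bijections of \<open>space M\<close> that satisfy the
  action law at every point. Since the inverse of \<open>\<phi> g\<close> is \<open>\<phi>\<close> of the inverse of \<open>g\<close>, these
  bijections are bimeasurable.
\<close>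

definition pmp_action ::
  "('g, 'b) monoid_scheme \<Rightarrow> 'x measure \<Rightarrow> ('g \<Rightarrow> 'x \<Rightarrow> 'x) \<Rightarrow> bool" where
  "pmp_action G M \<phi> \<longleftrightarrow> group_action G (space M) \<phi> \<and>
     (\<forall>g\<in>carrier G. \<phi> g \<in> measurable M M \<and> distr M M (\<phi> g) = M)"


section \<open>Partitions and Shannon entropy\<close>

definition countable_partition :: "'x measure \<Rightarrow> 'x set set \<Rightarrow> bool" where
  "countable_partition M \<alpha> \<longleftrightarrow> countable \<alpha> \<and> \<alpha> \<subseteq> sets M \<and> partition_on (space M) \<alpha>"

definition translate :: "('g \<Rightarrow> 'x \<Rightarrow> 'x) \<Rightarrow> 'g \<Rightarrow> 'x set set \<Rightarrow> 'x set set" where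
  "translate \<phi> g \<alpha> = (\<lambda>A. \<phi> g ` A) ` \<alpha>"

definition translate_join :: "('g \<Rightarrow> 'x \<Rightarrow> 'x) \<Rightarrow> 'g set \<Rightarrow> 'x set set \<Rightarrow> 'x set set" where
  "translate_join \<phi> F \<alpha> = common_refinement ((\<lambda>g. translate \<phi> g \<alpha>) ` F)"

text \<open>The summands are nonnegative, with \<open>0 \<cdot> log 0 = 0\<close>, so the sum always exists in \<open>[0, \<infinity>]\<close>.\<close>

definition shannon_entropy :: "'x measure \<Rightarrow> 'x set set \<Rightarrow> ereal" where
  "shannon_entropy M \<alpha> = (\<Sum>\<^sub>\<infinity>A\<in>\<alpha>. ereal (- measure M A * ln (measure M A)))"

definition invariant_sigma_algebra ::
  "('g, 'b) monoid_scheme \<Rightarrow> 'x measure \<Rightarrow> ('g \<Rightarrow> 'x \<Rightarrow> 'x) \<Rightarrow> 'x set set \<Rightarrow> 'x set set" where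
  "invariant_sigma_algebra G M \<phi> \<alpha> =
     \<Inter> {\<Sigma>. sigma_algebra (space M) \<Sigma> \<and> \<alpha> \<subseteq> \<Sigma> \<and>
            (\<forall>g\<in>carrier G. \<forall>A\<in>\<Sigma>. \<phi> g ` A \<in> \<Sigma>)}"

definition generating_partition ::
  "('g, 'b) monoid_scheme \<Rightarrow> 'x measure \<Rightarrow> ('g \<Rightarrow> 'x \<Rightarrow> 'x) \<Rightarrow> 'x set set \<Rightarrow> bool" where
  "generating_partition G M \<phi> \<alpha> \<longleftrightarrow> countable_partition M \<alpha> \<and>
     (\<forall>B\<in>sets M. \<exists>C\<in>invariant_sigma_algebra G M \<phi> \<alpha>. sym_diff B C \<in> null_sets M)"


section \<open>f-invariant entropy\<close>

text \<open>Only used when \<open>\<alpha>\<close> has finite entropy; then all summands are finite.\<close>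

definition F_entropy ::
  "'x measure \<Rightarrow> ('g \<Rightarrow> 'x \<Rightarrow> 'x) \<Rightarrow> 'g set \<Rightarrow> 'x set set \<Rightarrow> ereal" where
  "F_entropy M \<phi> S \<alpha> =
     ereal (1 - 2 * real (card S)) * shannon_entropy M \<alpha> +
     (\<Sum>s\<in>S. shannon_entropy M (common_refinement {translate \<phi> s \<alpha>, \<alpha>}))"

definition f_data ::
  "('g, 'b) monoid_scheme \<Rightarrow> 'x measure \<Rightarrow> ('g \<Rightarrow> 'x \<Rightarrow> 'x) \<Rightarrow> 'g set \<Rightarrow> 'x set set \<Rightarrow> bool" where
  "f_data G M \<phi> S \<alpha> \<longleftrightarrow> finite S \<and> free_generating_set G S \<and>
     generating_partition G M \<phi> \<alpha> \<and> shannon_entropy M \<alpha> < \<infinity>"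

definition f_defined ::
  "('g, 'b) monoid_scheme \<Rightarrow> 'x measure \<Rightarrow> ('g \<Rightarrow> 'x \<Rightarrow> 'x) \<Rightarrow> bool" where
  "f_defined G M \<phi> \<longleftrightarrow> fg_free_group G \<and>
     (\<exists>\<alpha>. generating_partition G M \<phi> \<alpha> \<and> shannon_entropy M \<alpha> < \<infinity>)"

text \<open>
  By theorems of Bowen the limit exists in \<open>[-\<infinity>, \<infinity>)\<close> and is the same for all admissible \<open>(S, \<alpha>)\<close>,
  so an arbitrary choice of \<open>(S, \<alpha>)\<close> determines the value. It is meaningful only under
  \<^const>\<open>f_defined\<close>, which says precisely that an admissible pair exists.
\<close>

definition f_entropy ::
  "('g, 'b) monoid_scheme \<Rightarrow> 'x measure \<Rightarrow> ('g \<Rightarrow> 'x \<Rightarrow> 'x) \<Rightarrow> ereal" where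
  "f_entropy G M \<phi> =
     (let (S, \<alpha>) = (SOME (S, \<alpha>). f_data G M \<phi> S \<alpha>)
      in lim (\<lambda>n. F_entropy M \<phi> S (translate_join \<phi> (word_ball G S n) \<alpha>)))"

end

theory Submission
  imports Defs
begin

text \<open>
  For a finite set \<open>D\<close> of labelled group elements let \<open>h D\<close> be the entropy of the corresponding join of
  translates of \<open>\<alpha>\<close> (generating for \<open>H\<close>) and \<open>\<beta>\<close> (generating for \<open>G\<close>, chosen in the definition of
  \<open>f\<close>). Let \<open>K \<supseteq> H\<close> have finite index. To a \<open>K\<close>-equivariant family \<open>A v\<close> of finite sets, indexed by
  the vertices \<open>v\<close> of the Cayley graph of \<open>G\<close>, attach the sum over the \<open>K\<close>-orbits of vertices and edges
  of \<open>(1 - 2 r) h (A v)\<close> and \<open>h (A v \<union> A (v s))\<close>. By submodularity of entropy this sum does not increase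
  if \<open>A v\<close> is enlarged by a part of \<open>A w\<close> for neighbours \<open>w\<close> of \<open>v\<close>.

  Start with \<open>A v = {v \<alpha>}\<close> for \<open>v \<in> K\<close> and \<open>A v = {}\<close> otherwise, where the sum is at most \<open>H(\<alpha>)\<close>.
  Spreading makes every \<open>A v\<close> exhaust the \<open>K\<close>-translates of \<open>\<alpha>\<close>, so \<open>v \<beta>\<close> can be added at little cost;
  spreading the \<open>\<beta>\<close>-part then makes the \<open>\<alpha>\<close>-part almost redundant, and what remains is the index
  \<open>[G : K]\<close> times \<open>F(B\<^sub>m \<beta>)\<close>. Hence \<open>[G : K] f \<le> H(\<alpha>)\<close>. The indices of the possible \<open>K\<close> are
  unbounded, so \<open>f \<le> 0\<close>.
\<close>

section \<open>Submodular functions on families of finite sets\<close>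

text \<open>A pair \<open>(x, l)\<close> stands for the translate by \<open>x\<close> of the
  partition with label \<open>l\<close>. Labels are fixed by the shift, so several partitions can be
  handled in one index set.\<close>

definition lshift :: "('g, 'b) monoid_scheme \<Rightarrow> 'g \<Rightarrow> ('g \<times> 'l) set \<Rightarrow> ('g \<times> 'l) set" where
  "lshift G g A = (\<lambda>(x, l). (g \<otimes>\<^bsub>G\<^esub> x, l)) ` A"

definition cells :: "('g, 'b) monoid_scheme \<Rightarrow> ('g \<times> 'l) set set" where
  "cells G = {A. finite A \<and> A \<subseteq> carrier G \<times> UNIV}"

lemma cells_simps [simp]:
  "{} \<in> cells G"
  "A \<union> B \<in> cells G \<longleftrightarrow> A \<in> cells G \<and> B \<in> cells G"
  "insert x A \<in> cells G \<longleftrightarrow> fst x \<in> carrier G \<and> A \<in> cells G"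
  by (cases x; auto simp: cells_def)+

lemma cells_subset: "A \<in> cells G \<Longrightarrow> B \<subseteq> A \<Longrightarrow> B \<in> cells G"
  by (auto simp: cells_def intro: finite_subset)

lemma lshift_Un [simp]: "lshift G g (A \<union> B) = lshift G g A \<union> lshift G g B"
  by (auto simp: lshift_def)

lemma lshift_UN [simp]: "lshift G g (\<Union>i\<in>I. A i) = (\<Union>i\<in>I. lshift G g (A i))"
  by (auto simp: lshift_def)

lemma lshift_empty [simp]: "lshift G g {} = {}"
  by (auto simp: lshift_def)

lemma (in group) lshift_cells [simp]: "g \<in> carrier G \<Longrightarrow> A \<in> cells G \<Longrightarrow> lshift G g A \<in> cells G"
  by (auto simp: lshift_def cells_def)

text \<open>These four properties of joint entropy suffice for the orbit sum estimates, which are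
  therefore carried out for an abstract \<open>h\<close>. Approximation by a generating partition
  enters later as a separate hypothesis.\<close>

locale submodular_entropy = group G for G :: "('g, 'b) monoid_scheme" (structure) +
  fixes h :: "('g \<times> 'l) set \<Rightarrow> real"
  assumes h_empty [simp]: "h {} = 0"
    and h_mono: "B \<in> cells G \<Longrightarrow> A \<subseteq> B \<Longrightarrow> h A \<le> h B"
    and h_submod: "A \<in> cells G \<Longrightarrow> B \<in> cells G \<Longrightarrow> h (A \<union> B) + h (A \<inter> B) \<le> h A + h B"
    and h_shift: "g \<in> carrier G \<Longrightarrow> A \<in> cells G \<Longrightarrow> h (lshift G g A) = h A"
begin

lemma h_nonneg: "A \<in> cells G \<Longrightarrow> 0 \<le> h A"
  using h_mono[of A "{}"] by simp

text \<open>Diminishing returns, the form in which submodularity is used throughout: it is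
  submodularity for \<open>A\<close> and \<open>B \<union> C\<close>, whose intersection still
  contains \<open>B\<close>. For entropy it says that conditioning on more lowers conditional
  entropy.\<close>

lemma h_increment:
  assumes "A \<in> cells G" "C \<in> cells G" "B \<subseteq> A"
  shows "h (A \<union> C) - h A \<le> h (B \<union> C) - h B"
proof -
  have B: "B \<in> cells G" using assms cells_subset by blast
  have "h B \<le> h (A \<inter> (B \<union> C))"
    using assms by (intro h_mono) (auto intro: cells_subset)
  moreover have "h (A \<union> (B \<union> C)) + h (A \<inter> (B \<union> C)) \<le> h A + h (B \<union> C)"
    using assms B by (intro h_submod) auto
  moreover have "A \<union> (B \<union> C) = A \<union> C" using assms by blast
  ultimately show ?thesis by simp
qed

lemma h_subadd: "A \<in> cells G \<Longrightarrow> B \<in> cells G \<Longrightarrow> h (A \<union> B) \<le> h A + h B"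
  using h_increment[of A B "{}"] by simp

text \<open>Elements of \<open>C\<close> are added one at a time, and \<open>h_increment\<close>
  compares each step with the same addition to the bare \<open>A\<close>.\<close>

lemma h_increment_sum:
  assumes "A \<in> cells G" "C \<in> cells G"
  shows "h (A \<union> C) - h A \<le> (\<Sum>c\<in>C. h (insert c A) - h A)"
proof -
  have "finite C" "C \<subseteq> carrier G \<times> UNIV" using assms by (auto simp: cells_def)
  then show ?thesis
  proof (induction C rule: finite_induct)
    case (insert c C)
    then have C: "C \<in> cells G" "{c} \<in> cells G" "fst c \<in> carrier G" by (auto simp: cells_def)
    have "h ((A \<union> C) \<union> {c}) - h (A \<union> C) \<le> h (A \<union> {c}) - h A"
      using C assms by (intro h_increment) auto
    with insert show ?case by simp
  qed simp
qed

end

section \<open>Orbit sums over the Cayley graph modulo a finite index subgroup\<close>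

locale equivariant_families = submodular_entropy G h
  for G :: "('g, 'b) monoid_scheme" (structure) and h :: "('g \<times> 'l) set \<Rightarrow> real" +
  fixes K S :: "'g set"
  assumes K: "subgroup K G" and finite_index: "finite (rcosets\<^bsub>G\<^esub> K)"
    and finite_S: "finite S" and S_carrier: "S \<subseteq> carrier G"
begin

text \<open>\<open>K\<close> acts from the left while edges join \<open>v\<close> to
  \<open>v \<otimes> s\<close> on the right, so the two operations commute and the vertex orbits are
  the right cosets of \<open>K\<close>.\<close>

definition equivariant :: "('g \<Rightarrow> ('g \<times> 'l) set) \<Rightarrow> bool" where
  "equivariant A \<longleftrightarrow> (\<forall>v\<in>carrier G. A v \<in> cells G \<and> (\<forall>k\<in>K. A (k \<otimes> v) = lshift G k (A v)))"

text \<open>Meant for functions that are constant on right cosets; for these the chosen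
  representatives do not matter.\<close>

definition coset_sum :: "('g \<Rightarrow> real) \<Rightarrow> real" where
  "coset_sum q = (\<Sum>c\<in>rcosets K. q (SOME v. v \<in> c))"

text \<open>An edge from \<open>v\<close> to \<open>v \<otimes> s\<close> is indexed by
  \<open>v\<close>. Each type \<open>s\<close> thus has one edge orbit per coset of
  \<open>K\<close>, which is why the edge part is again a sum over cosets.\<close>

definition euler :: "('g \<Rightarrow> ('g \<times> 'l) set) \<Rightarrow> real" where
  "euler A = (1 - 2 * real (card S)) * coset_sum (\<lambda>v. h (A v)) +
     (\<Sum>s\<in>S. coset_sum (\<lambda>v. h (A v \<union> A (v \<otimes> s))))"

lemma rep:
  assumes "c \<in> rcosets K"
  shows "(SOME v. v \<in> c) \<in> carrier G" "K #> (SOME v. v \<in> c) = c"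
proof -
  obtain a where a: "a \<in> carrier G" "c = K #> a" using assms by (auto simp: RCOSETS_def)
  have "(SOME v. v \<in> c) \<in> c"
    using a rcos_self[OF a(1) K] by (intro someI) auto
  then show "K #> (SOME v. v \<in> c) = c" 
    using a repr_independence[OF _ a(1) K] by auto
  show "(SOME v. v \<in> c) \<in> carrier G"
    using \<open>(SOME v. v \<in> c) \<in> c\<close> a K by (meson r_coset_subset_G subgroup.subset subsetD)
qed

lemma rep_rel:
  assumes "v \<in> carrier G"
  obtains k where "k \<in> K" "v = k \<otimes> (SOME w. w \<in> K #> v)"
proof -
  have c: "K #> v \<in> rcosets K" using assms by (auto simp: RCOSETS_def)
  have "v \<in> K #> (SOME w. w \<in> K #> v)" using rep(2)[OF c] rcos_self[OF assms K] by simp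
  then show ?thesis using that by (auto simp: r_coset_def)
qed

lemma coset_sum_mono: "(\<And>v. v \<in> carrier G \<Longrightarrow> p v \<le> q v) \<Longrightarrow> coset_sum p \<le> coset_sum q"
  unfolding coset_sum_def by (intro sum_mono) (auto simp: rep)

lemma coset_sum_cong: "(\<And>v. v \<in> carrier G \<Longrightarrow> p v = q v) \<Longrightarrow> coset_sum p = coset_sum q"
  unfolding coset_sum_def by (intro sum.cong) (auto simp: rep)

lemma coset_sum_add: "coset_sum (\<lambda>v. p v + q v) = coset_sum p + coset_sum q"
  and coset_sum_diff: "coset_sum (\<lambda>v. p v - q v) = coset_sum p - coset_sum q"
  and coset_sum_const: "coset_sum (\<lambda>v. a) = real (card (rcosets K)) * a"
  by (simp_all add: coset_sum_def sum.distrib sum_subtractf)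

text \<open>Right multiplication by \<open>s\<close> permutes the right cosets of \<open>K\<close>,
  and invariance of \<open>q\<close> removes the dependence on representatives.\<close>

lemma coset_sum_shift:
  assumes q: "\<And>k v. k \<in> K \<Longrightarrow> v \<in> carrier G \<Longrightarrow> q (k \<otimes> v) = q v" and s: "s \<in> carrier G"
  shows "coset_sum (\<lambda>v. q (v \<otimes> s)) = coset_sum q"
proof -
  have sub: "K \<subseteq> carrier G" using K by (rule subgroup.subset)
  have q_rep: "q v = q (SOME w. w \<in> K #> v)" if "v \<in> carrier G" for v
    using rep_rel[OF that] q rep(1)[of "K #> v"] that by (metis RCOSETS_def UN_I insertI1)
  have cs: "c #> s \<in> rcosets K" "(c #> s) #> inv s = c" "c #> inv s \<in> rcosets K" "(c #> inv s) #> s = c"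
    if "c \<in> rcosets K" for c
    using that s sub by (auto simp: RCOSETS_def coset_mult_assoc m_assoc)
  have "coset_sum (\<lambda>v. q (v \<otimes> s)) = (\<Sum>c\<in>rcosets K. q (SOME w. w \<in> c #> s))"
    unfolding coset_sum_def
  proof (rule sum.cong)
    fix c assume c: "c \<in> rcosets K"
    then show "q ((SOME v. v \<in> c) \<otimes> s) = q (SOME w. w \<in> c #> s)"
      using q_rep[of "(SOME v. v \<in> c) \<otimes> s"] rep[OF c] s sub
      by (simp add: coset_mult_assoc[symmetric])
  qed simp
  also have "\<dots> = coset_sum q"
    unfolding coset_sum_def
    by (rule sum.reindex_bij_witness[of _ "\<lambda>c. c #> inv s" "\<lambda>c. c #> s"]) (use cs in auto)
  finally show ?thesis .
qed

lemma equivariant_cells: "equivariant A \<Longrightarrow> v \<in> carrier G \<Longrightarrow> A v \<in> cells G"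
  by (simp add: equivariant_def)

lemma equivariant_Un: "equivariant A \<Longrightarrow> equivariant B \<Longrightarrow> equivariant (\<lambda>v. A v \<union> B v)"
  by (simp add: equivariant_def)

lemma equivariant_mult:
  assumes "equivariant A" "s \<in> carrier G"
  shows "equivariant (\<lambda>v. A (v \<otimes> s))"
  using assms subgroup.mem_carrier[OF K] by (auto simp: equivariant_def m_assoc)

lemma equivariant_inv:
  "equivariant A \<Longrightarrow> k \<in> K \<Longrightarrow> v \<in> carrier G \<Longrightarrow> h (A (k \<otimes> v)) = h (A v)"
  using subgroup.mem_carrier[OF K] by (auto simp: equivariant_def h_shift)

lemma coset_sum_h_mult:
  "equivariant A \<Longrightarrow> s \<in> carrier G \<Longrightarrow> coset_sum (\<lambda>v. h (A (v \<otimes> s))) = coset_sum (\<lambda>v. h (A v))"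
  by (rule coset_sum_shift[where q = "\<lambda>v. h (A v)"]) (auto intro: equivariant_inv)

text \<open>
  With \<open>D\<close> the total increment of \<open>h (A v)\<close> over the vertex orbits, the vertex terms change by
  \<open>(1 - 2 r) D\<close> and each of the \<open>r\<close> edge types by at most \<open>2 D\<close>; for the type of \<open>s\<close> one of the two
  enlargements is already present in the edge, which saves one \<open>D\<close>.
\<close>

lemma euler_split:
  assumes A: "equivariant A" and C: "equivariant C" and s: "s \<in> S"
    and l: "l = s \<or> l = inv s" and CA: "\<And>v. v \<in> carrier G \<Longrightarrow> C v \<subseteq> A (v \<otimes> l)"
  shows "euler (\<lambda>v. A v \<union> C v) \<le> euler A"
proof -
  define \<delta> where "\<delta> v = h (A v \<union> C v) - h (A v)" for v
  define D where "D = coset_sum \<delta>"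
  have S: "t \<in> carrier G" if "t \<in> S" for t using that S_carrier by auto
  note AC = equivariant_cells[OF A] equivariant_cells[OF C]
  have lshift: "coset_sum (\<lambda>v. \<delta> (v \<otimes> t)) = D" if "t \<in> S" for t
    unfolding D_def using equivariant_inv[OF A] equivariant_inv[OF equivariant_Un[OF A C]] S[OF that]
    by (intro coset_sum_shift) (auto simp: \<delta>_def)
  let ?e = "\<lambda>t v. h ((A v \<union> C v) \<union> (A (v \<otimes> t) \<union> C (v \<otimes> t))) - h (A v \<union> A (v \<otimes> t))"
  have inc1: "h ((A v \<union> A w) \<union> C v) - h (A v \<union> A w) \<le> \<delta> v" 
    if "v \<in> carrier G" "w \<in> carrier G" for v w
    unfolding \<delta>_def using that by (intro h_increment) (auto simp: AC)
  have inc2: "h ((A v \<union> A w) \<union> C w) - h (A v \<union> A w) \<le> \<delta> w" 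
    if "v \<in> carrier G" "w \<in> carrier G" for v w
    unfolding \<delta>_def using that by (intro h_increment) (auto simp: AC)
  have gen: "coset_sum (?e t) \<le> 2 * D" if t: "t \<in> S" for t
  proof -
    have "coset_sum (?e t) \<le> coset_sum (\<lambda>v. \<delta> v + \<delta> (v \<otimes> t))"
    proof (rule coset_sum_mono)
      fix v assume v: "v \<in> carrier G"
      let ?w = "v \<otimes> t"
      have w: "?w \<in> carrier G" using v S[OF t] by simp
      have "h ((A v \<union> A ?w \<union> C v) \<union> C ?w) - h (A v \<union> A ?w \<union> C v) \<le> \<delta> ?w"
        unfolding \<delta>_def using v w by (intro h_increment) (auto simp: AC)
      moreover have "(A v \<union> C v) \<union> (A ?w \<union> C ?w) = (A v \<union> A ?w \<union> C v) \<union> C ?w" by blast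
      ultimately show "?e t v \<le> \<delta> v + \<delta> ?w" using inc1[OF v w] by simp
    qed
    then show ?thesis using lshift[OF t] by (simp add: coset_sum_add D_def)
  qed
  have special: "coset_sum (?e s) \<le> D"
    using l
  proof
    assume l: "l = s"
    have "coset_sum (?e s) \<le> coset_sum (\<lambda>v. \<delta> (v \<otimes> s))"
    proof (rule coset_sum_mono)
      fix v assume v: "v \<in> carrier G"
      let ?w = "v \<otimes> s"
      have w: "?w \<in> carrier G" using v S[OF s] by simp
      have "(A v \<union> C v) \<union> (A ?w \<union> C ?w) = (A v \<union> A ?w) \<union> C ?w" using CA[OF v] l by blast
      then show "?e s v \<le> \<delta> ?w" using inc2[OF v w] by simp
    qed
    then show ?thesis using lshift[OF s] by simp
  next
    assume l: "l = inv s"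
    have "coset_sum (?e s) \<le> coset_sum \<delta>"
    proof (rule coset_sum_mono)
      fix v assume v: "v \<in> carrier G"
      let ?w = "v \<otimes> s"
      have w: "?w \<in> carrier G" using v S[OF s] by simp
      \<comment> \<open>For the inverse letter the absorbed enlargement is the one at the far end of
        the edge: the neighbour of \<open>?w\<close> along \<open>inv s\<close> is
        \<open>v\<close>.\<close>
      have "C ?w \<subseteq> A v" using CA[OF w] l v S[OF s] by (simp add: m_assoc)
      then have "(A v \<union> C v) \<union> (A ?w \<union> C ?w) = (A v \<union> A ?w) \<union> C v" by blast
      then show "?e s v \<le> \<delta> v" using inc1[OF v w] by simp
    qed
    then show ?thesis by (simp add: D_def)
  qed
  have "(\<Sum>t\<in>S. coset_sum (?e t)) = coset_sum (?e s) + (\<Sum>t\<in>S - {s}. coset_sum (?e t))"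
    using s finite_S by (simp add: sum.remove)
  also have "\<dots> \<le> D + (\<Sum>t\<in>S - {s}. 2 * D)"
    using special gen by (intro add_mono sum_mono) auto
  also have "\<dots> = (2 * real (card S) - 1) * D"
    using card.remove[OF finite_S s] by (simp add: algebra_simps)
  finally have *: "(\<Sum>t\<in>S. coset_sum (?e t)) \<le> (2 * real (card S) - 1) * D" .
  \<comment> \<open>The vertex contribution \<open>(1 - 2 * real (card S)) * D\<close> is exactly
    the negative of the bound in \<open>*\<close>.\<close>
  have "euler (\<lambda>v. A v \<union> C v) - euler A = (1 - 2 * real (card S)) * D + (\<Sum>t\<in>S. coset_sum (?e t))"
    unfolding euler_def D_def \<delta>_def by (simp add: coset_sum_diff sum_subtractf algebra_simps)
  with * show ?thesis by (simp add: algebra_simps)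
qed

lemma eval_letter_closed: "l \<in> S \<times> UNIV \<Longrightarrow> eval_letter G l \<in> carrier G"
  using S_carrier by (auto simp: eval_letter_def)

text \<open>One simultaneous spreading of \<open>C\<close> to all neighbours along letters in
  \<open>L\<close>. Letters are processed singly by \<open>euler_split\<close>; its containment
  hypothesis persists because the family only grows and \<open>C\<close> stays the original
  one.\<close>

lemma euler_round:
  assumes A: "equivariant A" and C: "equivariant C" and CA: "\<And>v. v \<in> carrier G \<Longrightarrow> C v \<subseteq> A v"
    and L: "L \<subseteq> S \<times> UNIV"
  shows "equivariant (\<lambda>v. A v \<union> (\<Union>l\<in>L. C (v \<otimes> eval_letter G l))) \<and>
    euler (\<lambda>v. A v \<union> (\<Union>l\<in>L. C (v \<otimes> eval_letter G l))) \<le> euler A"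
proof -
  have "finite L" using finite_subset[OF L] finite_S by simp
  then show ?thesis using L
  proof (induction L rule: finite_induct)
    case empty
    show ?case using A by simp
  next
    case (insert l L)
    define B where "B v = A v \<union> (\<Union>l\<in>L. C (v \<otimes> eval_letter G l))" for v
    define C' where "C' v = C (v \<otimes> eval_letter G l)" for v
    have l: "eval_letter G l \<in> carrier G" "fst l \<in> S" using insert.prems eval_letter_closed by auto
    have B: "equivariant B" "euler B \<le> euler A" using insert unfolding B_def by auto
    have C': "equivariant C'" unfolding C'_def using C l by (intro equivariant_mult)
    have "euler (\<lambda>v. B v \<union> C' v) \<le> euler B"
    proof (rule euler_split[OF B(1) C' l(2), of "eval_letter G l"])
      show "C' v \<subseteq> B (v \<otimes> eval_letter G l)" if "v \<in> carrier G" for v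
        using CA[of "v \<otimes> eval_letter G l"] that l unfolding C'_def B_def by auto
    qed (auto simp: eval_letter_def)
    moreover have "(\<lambda>v. B v \<union> C' v) = (\<lambda>v. A v \<union> (\<Union>l\<in>insert l L. C (v \<otimes> eval_letter G l)))"
      by (auto simp: B_def C'_def fun_eq_iff)
    ultimately show ?case using B equivariant_Un[OF B(1) C'] by simp
  qed
qed

text \<open>By subadditivity each edge type contributes at most two vertex sums, and
  \<open>(1 - 2 r) + 2 r = 1\<close> for \<open>r = card S\<close>.\<close>

lemma euler_le_coset_sum:
  assumes A: "equivariant A"
  shows "euler A \<le> coset_sum (\<lambda>v. h (A v))"
proof -
  have "coset_sum (\<lambda>v. h (A v \<union> A (v \<otimes> s))) \<le> 2 * coset_sum (\<lambda>v. h (A v))" if "s \<in> S" for s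
  proof -
    have s: "s \<in> carrier G" using that S_carrier by auto
    have "coset_sum (\<lambda>v. h (A v \<union> A (v \<otimes> s))) \<le> coset_sum (\<lambda>v. h (A v) + h (A (v \<otimes> s)))"
      using s by (intro coset_sum_mono h_subadd) (auto simp: equivariant_cells[OF A])
    then show ?thesis using coset_sum_h_mult[OF A s] by (simp add: coset_sum_add)
  qed
  then have "(\<Sum>s\<in>S. coset_sum (\<lambda>v. h (A v \<union> A (v \<otimes> s)))) \<le> (\<Sum>s\<in>S. 2 * coset_sum (\<lambda>v. h (A v)))"
    by (rule sum_mono)
  then show ?thesis by (simp add: euler_def algebra_simps)
qed

text \<open>Here \<open>C\<close> need not be present at neighbouring vertices, so each edge type
  may cost two full increments. The vertex terms only help, as their coefficient is nonpositive for
  nonempty \<open>S\<close>.\<close>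

lemma euler_add_le:
  assumes A: "equivariant A" and C: "equivariant C" and S: "S \<noteq> {}"
  shows "euler (\<lambda>v. A v \<union> C v) \<le> euler A + 2 * real (card S) * coset_sum (\<lambda>v. h (A v \<union> C v) - h (A v))"
proof -
  define \<delta> where "\<delta> v = h (A v \<union> C v) - h (A v)" for v
  note AC = equivariant_cells[OF A] equivariant_cells[OF C]
  have "coset_sum (\<lambda>v. h ((A v \<union> C v) \<union> (A (v \<otimes> s) \<union> C (v \<otimes> s))))
      \<le> coset_sum (\<lambda>v. h (A v \<union> A (v \<otimes> s))) + 2 * coset_sum \<delta>" if "s \<in> S" for s
  proof -
    have s: "s \<in> carrier G" using that S_carrier by auto
    have "coset_sum (\<lambda>v. h ((A v \<union> C v) \<union> (A (v \<otimes> s) \<union> C (v \<otimes> s))))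
        \<le> coset_sum (\<lambda>v. h (A v \<union> A (v \<otimes> s)) + (\<delta> v + \<delta> (v \<otimes> s)))"
    proof (rule coset_sum_mono)
      fix v assume v: "v \<in> carrier G"
      let ?w = "v \<otimes> s"
      have w: "?w \<in> carrier G" using v s by simp
      have "h ((A v \<union> A ?w) \<union> C v) - h (A v \<union> A ?w) \<le> \<delta> v"
        unfolding \<delta>_def using v w by (intro h_increment) (auto simp: AC)
      moreover have "h ((A v \<union> A ?w \<union> C v) \<union> C ?w) - h (A v \<union> A ?w \<union> C v) \<le> \<delta> ?w"
        unfolding \<delta>_def using v w by (intro h_increment) (auto simp: AC)
      moreover have "(A v \<union> C v) \<union> (A ?w \<union> C ?w) = (A v \<union> A ?w \<union> C v) \<union> C ?w" by blast
      ultimately show "h ((A v \<union> C v) \<union> (A ?w \<union> C ?w)) \<le> h (A v \<union> A ?w) + (\<delta> v + \<delta> ?w)" by simp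
    qed
    moreover have "coset_sum (\<lambda>v. \<delta> (v \<otimes> s)) = coset_sum \<delta>"
      using equivariant_inv[OF A] equivariant_inv[OF equivariant_Un[OF A C]] s
      by (intro coset_sum_shift) (auto simp: \<delta>_def)
    ultimately show ?thesis by (simp add: coset_sum_add)
  qed
  then have "(\<Sum>s\<in>S. coset_sum (\<lambda>v. h ((A v \<union> C v) \<union> (A (v \<otimes> s) \<union> C (v \<otimes> s)))))
      \<le> (\<Sum>s\<in>S. coset_sum (\<lambda>v. h (A v \<union> A (v \<otimes> s))) + 2 * coset_sum \<delta>)"
    by (rule sum_mono)
  moreover have "(1 - 2 * real (card S)) * coset_sum (\<lambda>v. h (A v \<union> C v))
      \<le> (1 - 2 * real (card S)) * coset_sum (\<lambda>v. h (A v))"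
  proof (rule mult_left_mono_neg)
    show "coset_sum (\<lambda>v. h (A v)) \<le> coset_sum (\<lambda>v. h (A v \<union> C v))"
      by (intro coset_sum_mono h_mono) (auto simp: AC)
    show "1 - 2 * real (card S) \<le> 0"
      using S finite_S card_gt_0_iff[of S] by linarith
  qed
  moreover have "coset_sum \<delta> = coset_sum (\<lambda>v. h (A v \<union> C v) - h (A v))"
    by (simp add: \<delta>_def[abs_def])
  ultimately show ?thesis by (simp add: euler_def sum.distrib algebra_simps)
qed

text \<open>When \<open>C\<close> is removed the edge terms drop, and only the negatively weighted
  vertex terms can make the sum grow, by at most \<open>2 r - 1\<close> total increments for
  \<open>r = card S\<close>.\<close>

lemma euler_sub_le:
  assumes A: "equivariant A" and C: "equivariant C" and S: "S \<noteq> {}"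
  shows "euler A \<le> euler (\<lambda>v. A v \<union> C v) + 2 * real (card S) * coset_sum (\<lambda>v. h (A v \<union> C v) - h (A v))"
proof -
  note AC = equivariant_cells[OF A] equivariant_cells[OF C]
  have "(\<Sum>s\<in>S. coset_sum (\<lambda>v. h (A v \<union> A (v \<otimes> s))))
      \<le> (\<Sum>s\<in>S. coset_sum (\<lambda>v. h ((A v \<union> C v) \<union> (A (v \<otimes> s) \<union> C (v \<otimes> s)))))"
    using S_carrier by (intro sum_mono coset_sum_mono h_mono) (auto simp: AC subset_iff)
  moreover have "coset_sum (\<lambda>v. h (A v)) \<le> coset_sum (\<lambda>v. h (A v \<union> C v))"
    by (intro coset_sum_mono h_mono) (auto simp: AC)
  ultimately show ?thesis by (simp add: euler_def coset_sum_diff algebra_simps)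
qed

end

section \<open>Entropy of countable-valued observables\<close>

text \<open>
  A countable partition is encoded by any function that has its blocks as fibres; entropy is then the
  integral of the information function, and a join of partitions is a tuple of functions.
\<close>

definition observable :: "'x measure \<Rightarrow> ('x \<Rightarrow> 'c) \<Rightarrow> bool" where
  "observable M V \<longleftrightarrow> countable (V ` space M) \<and> (\<forall>c. V -` {c} \<inter> space M \<in> sets M)"

definition fibre :: "'x measure \<Rightarrow> ('x \<Rightarrow> 'c) \<Rightarrow> 'x \<Rightarrow> 'x set" where
  "fibre M V x = V -` {V x} \<inter> space M"

definition determines :: "'x measure \<Rightarrow> ('x \<Rightarrow> 'c) \<Rightarrow> ('x \<Rightarrow> 'd) \<Rightarrow> bool" where
  "determines M V Y \<longleftrightarrow> (\<forall>x\<in>space M. \<forall>y\<in>space M. V x = V y \<longrightarrow> Y x = Y y)"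

definition obs_entropy :: "'x measure \<Rightarrow> ('x \<Rightarrow> 'c) \<Rightarrow> ennreal" where
  "obs_entropy M V = (\<integral>\<^sup>+x. ennreal (- ln (measure M (fibre M V x))) \<partial>M)"

lemma observable_sets: "observable M V \<Longrightarrow> V -` {c} \<inter> space M \<in> sets M"
  by (simp add: observable_def)

lemma observable_fibre: "observable M V \<Longrightarrow> fibre M V x \<in> sets M"
  by (simp add: observable_def fibre_def)

lemma observable_fun_measurable:
  assumes V: "observable M V"
  shows "(\<lambda>x. f (V x)) \<in> borel_measurable M"
proof -
  have "V \<in> measurable M (count_space (V ` space M))"
  proof (rule measurableI)
    fix B assume "B \<in> sets (count_space (V ` space M))"
    then have "countable B" using V by (auto simp: observable_def intro: countable_subset)
    then have "(\<Union>c\<in>B. V -` {c} \<inter> space M) \<in> sets M"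
      using V by (intro sets.countable_UN') (auto simp: observable_def)
    moreover have "(\<Union>c\<in>B. V -` {c} \<inter> space M) = V -` B \<inter> space M" by auto
    ultimately show "V -` B \<inter> space M \<in> sets M" by simp
  qed simp
  then show ?thesis by (rule measurable_compose) simp
qed

text \<open>\<open>Y\<close> factors through \<open>V\<close> by a map \<open>g\<close> that
  evaluates \<open>Y\<close> at a chosen point of each fibre of \<open>V\<close>. The fibres of
  \<open>Y\<close> are then countable unions of fibres of \<open>V\<close>.\<close>

lemma observable_determined:
  assumes V: "observable M V" and d: "determines M V Y"
  shows "observable M Y"
proof -
  define g where "g c = Y (SOME x. x \<in> space M \<and> V x = c)" for c
  have g: "Y x = g (V x)" if "x \<in> space M" for x
  proof -
    have "(SOME y. y \<in> space M \<and> V y = V x) \<in> space M \<and> V (SOME y. y \<in> space M \<and> V y = V x) = V x"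
      using that by (rule_tac someI) auto
    then show ?thesis using d that unfolding determines_def g_def by metis
  qed
  have c: "countable (V ` space M)" using V by (simp add: observable_def)
  have "Y ` space M = g ` V ` space M" using g by (auto simp: image_image)
  moreover have "Y -` {c} \<inter> space M = (\<Union>d\<in>{d\<in>V ` space M. g d = c}. V -` {d} \<inter> space M)" for c
    using g by auto
  moreover have "(\<Union>d\<in>{d\<in>V ` space M. g d = c}. V -` {d} \<inter> space M) \<in> sets M" for c
    using c V by (intro sets.countable_UN') (auto simp: observable_def)
  ultimately show ?thesis using c by (simp add: observable_def)
qed

lemma observable_Pair:
  assumes "observable M V" "observable M Y"
  shows "observable M (\<lambda>x. (V x, Y x))"
  unfolding observable_def
proof (intro conjI allI)
  have "(\<lambda>x. (V x, Y x)) ` space M \<subseteq> V ` space M \<times> Y ` space M" by auto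
  then show "countable ((\<lambda>x. (V x, Y x)) ` space M)"
    by (rule countable_subset) (use assms in \<open>simp add: observable_def\<close>)
  fix c :: "'b \<times> 'c"
  have "(\<lambda>x. (V x, Y x)) -` {c} \<inter> space M = (V -` {fst c} \<inter> space M) \<inter> (Y -` {snd c} \<inter> space M)"
    by (cases c) auto
  then show "(\<lambda>x. (V x, Y x)) -` {c} \<inter> space M \<in> sets M"
    using assms by (auto simp: observable_def)
qed

lemma observable_indicator: "A \<in> sets M \<Longrightarrow> observable M (\<lambda>x. x \<in> A)"
proof -
  assume A: "A \<in> sets M"
  have "(\<lambda>x. x \<in> A) -` {c} \<inter> space M \<in> sets M" for c
  proof (cases c)
    case True
    then have "(\<lambda>x. x \<in> A) -` {c} \<inter> space M = A" using sets.sets_into_space[OF A] by auto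
    then show ?thesis using A by simp
  next
    case False
    then have "(\<lambda>x. x \<in> A) -` {c} \<inter> space M = space M - A" by auto
    then show ?thesis using A by simp
  qed
  moreover have "countable ((\<lambda>x. x \<in> A) ` space M)" by simp
  ultimately show ?thesis by (simp add: observable_def)
qed

text \<open>For each point only the term with \<open>c = V x\<close> survives in the sum over
  values; the countable range then allows sum and integral to be exchanged.\<close>

lemma nn_integral_fibres:
  assumes V: "observable M V" and B: "B \<in> sets M"
  shows "(\<integral>\<^sup>+x. f (V x) * indicator B x \<partial>M)
    = (\<integral>\<^sup>+c. f c * emeasure M (V -` {c} \<inter> B) \<partial>count_space UNIV)"
proof -
  let ?R = "V ` space M"
  have sets: "V -` {c} \<inter> B \<in> sets M" for c
  proof -
    have "V -` {c} \<inter> B = (V -` {c} \<inter> space M) \<inter> B" using sets.sets_into_space[OF B] by auto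
    then show ?thesis using V B by (auto simp: observable_def)
  qed
  have "(\<integral>\<^sup>+x. f (V x) * indicator B x \<partial>M)
      = (\<integral>\<^sup>+x. \<integral>\<^sup>+c. f c * indicator (V -` {c} \<inter> B) x \<partial>count_space ?R \<partial>M)"
  proof (rule nn_integral_cong)
    fix x assume x: "x \<in> space M"
    have "(\<integral>\<^sup>+c. f c * indicator (V -` {c} \<inter> B) x \<partial>count_space ?R)
        = (\<Sum>c\<in>{V x}. f c * indicator (V -` {c} \<inter> B) x)"
      using x by (intro nn_integral_count_space') auto
    then show "f (V x) * indicator B x = (\<integral>\<^sup>+c. f c * indicator (V -` {c} \<inter> B) x \<partial>count_space ?R)"
      by (simp add: indicator_def)
  qed
  also have "\<dots> = (\<integral>\<^sup>+c. \<integral>\<^sup>+x. f c * indicator (V -` {c} \<inter> B) x \<partial>M \<partial>count_space ?R)"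
    using V sets by (intro nn_integral_count_space_nn_integral) (auto simp: observable_def)
  also have "\<dots> = (\<integral>\<^sup>+c. f c * emeasure M (V -` {c} \<inter> B) \<partial>count_space ?R)"
    using sets by (simp add: nn_integral_cmult_indicator)
  also have "\<dots> = (\<integral>\<^sup>+c. f c * emeasure M (V -` {c} \<inter> B) * indicator ?R c \<partial>count_space UNIV)"
    by (rule nn_integral_count_space_indicator) simp
  also have "\<dots> = (\<integral>\<^sup>+c. f c * emeasure M (V -` {c} \<inter> B) \<partial>count_space UNIV)"
  proof (rule nn_integral_cong)
    fix c
    have "V -` {c} \<inter> B = {}" if "c \<notin> ?R" using that sets.sets_into_space[OF B] by auto
    then show "f c * emeasure M (V -` {c} \<inter> B) * indicator ?R c = f c * emeasure M (V -` {c} \<inter> B)"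
      by (auto simp: indicator_def)
  qed
  finally show ?thesis .
qed

lemma sum_emeasure_fibres:
  assumes "observable M V" "B \<in> sets M"
  shows "(\<integral>\<^sup>+c. emeasure M (V -` {c} \<inter> B) \<partial>count_space UNIV) = emeasure M B"
  using nn_integral_fibres[OF assms, of "\<lambda>_. 1"] assms by simp

context prob_space
begin

lemma nn_integral_observable:
  assumes "observable M V"
  shows "(\<integral>\<^sup>+x. f (V x) \<partial>M) = (\<integral>\<^sup>+c. f c * emeasure M (V -` {c} \<inter> space M) \<partial>count_space UNIV)"
proof -
  have "(\<integral>\<^sup>+x. f (V x) \<partial>M) = (\<integral>\<^sup>+x. f (V x) * indicator (space M) x \<partial>M)"
    by (intro nn_integral_cong) simp
  then show ?thesis using nn_integral_fibres[OF assms, of "space M" f] by simp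
qed

text \<open>There are only countably many fibres, so those of measure zero can be discarded
  together. Almost everywhere \<open>ln\<close> is thus evaluated away from its default value
  \<open>ln 0 = 0\<close>.\<close>

lemma AE_fibre_pos:
  assumes "observable M V"
  shows "AE x in M. 0 < prob (fibre M V x)"
proof -
  let ?I = "{c \<in> V ` space M. prob (V -` {c} \<inter> space M) = 0}"
  have "(\<Union>c\<in>?I. V -` {c} \<inter> space M) \<in> null_sets M"
    using assms by (intro null_sets_UN') (auto simp: observable_def null_sets_def emeasure_eq_measure)
  then show ?thesis
    by (rule AE_I') (auto simp: fibre_def measure_nonneg less_le)
qed

lemma fibre_entropy_measurable [measurable]:
  assumes "observable M V"
  shows "(\<lambda>x. prob (fibre M V x)) \<in> borel_measurable M"
  using observable_fun_measurable[OF assms, of "\<lambda>c. prob (V -` {c} \<inter> space M)"]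
  by (simp add: fibre_def)

lemma ln_prob_nonneg: "0 \<le> - ln (prob A)"
proof (cases "prob A = 0")
  case False
  then have "0 < prob A" by (simp add: measure_nonneg less_le)
  then show ?thesis using prob_le_1[of A] by simp
qed simp

text \<open>The information functions compare pointwise, since a finer observable has smaller
  fibres. On a null fibre the default \<open>ln 0 = 0\<close> could break this, hence the almost
  everywhere version.\<close>

lemma obs_entropy_mono:
  assumes V: "observable M V" and d: "determines M V Y"
  shows "obs_entropy M Y \<le> obs_entropy M V"
  unfolding obs_entropy_def
proof (rule nn_integral_mono_AE)
  have Y: "observable M Y" using assms by (rule observable_determined)
  show "AE x in M. ennreal (- ln (prob (fibre M Y x))) \<le> ennreal (- ln (prob (fibre M V x)))"
    using AE_fibre_pos[OF V]
  proof (rule AE_mp, intro AE_I2 impI)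
    fix x assume x: "x \<in> space M" and pos: "0 < prob (fibre M V x)"
    have "fibre M V x \<subseteq> fibre M Y x" using d x unfolding determines_def fibre_def by blast
    then have "prob (fibre M V x) \<le> prob (fibre M Y x)"
      using Y by (intro finite_measure_mono observable_fibre)
    then show "ennreal (- ln (prob (fibre M Y x))) \<le> ennreal (- ln (prob (fibre M V x)))"
      using pos by (intro ennreal_leI) simp
  qed
qed

lemma obs_entropy_cong:
  assumes "\<And>x y. x \<in> space M \<Longrightarrow> y \<in> space M \<Longrightarrow> V x = V y \<longleftrightarrow> Y x = Y y"
  shows "obs_entropy M V = obs_entropy M Y"
proof -
  have "fibre M V x = fibre M Y x" if "x \<in> space M" for x
    using assms[OF _ that] by (auto simp: fibre_def)
  then show ?thesis unfolding obs_entropy_def by (intro nn_integral_cong) simp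
qed

text \<open>The integrand is the density ratio between the coupling that makes \<open>V\<close> and
  \<open>Y\<close> independent given \<open>Z\<close> and their true joint law with
  \<open>Z\<close>. Its integral is the mass of that coupling on the support of the true law, hence
  at most 1.\<close>

lemma conditional_independence_ratio_le_1:
  assumes V: "observable M V" and Y: "observable M Y" and Z: "observable M Z"
  defines "XZ \<equiv> \<lambda>x. (V x, Z x)" and "YZ \<equiv> \<lambda>x. (Y x, Z x)" and "XYZ \<equiv> \<lambda>x. (V x, Y x, Z x)"
  shows "(\<integral>\<^sup>+x. ennreal (prob (fibre M XZ x) * prob (fibre M YZ x)
      / (prob (fibre M XYZ x) * prob (fibre M Z x))) \<partial>M) \<le> 1"
proof -
  note obs = observable_Pair[OF V Z, folded XZ_def] observable_Pair[OF Y Z, folded YZ_def]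
    observable_Pair[OF V observable_Pair[OF Y Z], folded XYZ_def]
  define p where "p a c = prob (XZ -` {(a, c)} \<inter> space M)" for a c
  define q where "q b c = prob (YZ -` {(b, c)} \<inter> space M)" for b c
  define r where "r c = prob (Z -` {c} \<inter> space M)" for c
  define s where "s w = prob (XYZ -` {w} \<inter> space M)" for w
  define f where "f = (\<lambda>(a, b, c). ennreal (p a c * q b c / (s (a, b, c) * r c)))"
  have "(\<integral>\<^sup>+x. ennreal (prob (fibre M XZ x) * prob (fibre M YZ x)
      / (prob (fibre M XYZ x) * prob (fibre M Z x))) \<partial>M) = (\<integral>\<^sup>+x. f (XYZ x) \<partial>M)"
    by (simp add: f_def p_def q_def r_def s_def XZ_def YZ_def XYZ_def fibre_def)
  also have "\<dots> = (\<integral>\<^sup>+w. f w * ennreal (s w) \<partial>count_space UNIV)"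
    by (simp add: nn_integral_observable[OF obs(3)] s_def emeasure_eq_measure)
  \<comment> \<open>The sum over triples is arranged with \<open>a\<close> innermost, so that
    summing \<open>p a c\<close> over \<open>a\<close> produces the marginal
    \<open>r c\<close>.\<close>
  also have "\<dots> = (\<integral>\<^sup>+bc. \<integral>\<^sup>+a. f (a, bc) * ennreal (s (a, bc)) \<partial>count_space UNIV \<partial>count_space UNIV)"
    by (rule nn_integral_snd_count_space[of "\<lambda>w. f w * ennreal (s w)", symmetric])
  also have "\<dots> \<le> (\<integral>\<^sup>+bc. \<integral>\<^sup>+a. ennreal (q (fst bc) (snd bc) / r (snd bc)) *
      emeasure M (V -` {a} \<inter> (Z -` {snd bc} \<inter> space M)) \<partial>count_space UNIV \<partial>count_space UNIV)"
  proof (intro nn_integral_mono)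
    fix bc :: "'c \<times> 'd" and a :: 'b
    obtain b c where bc: "bc = (b, c)" by (cases bc)
    have p: "emeasure M (V -` {a} \<inter> (Z -` {c} \<inter> space M)) = ennreal (p a c)"
    proof -
      have "V -` {a} \<inter> (Z -` {c} \<inter> space M) = XZ -` {(a, c)} \<inter> space M" by (auto simp: XZ_def)
      then show ?thesis by (simp add: p_def emeasure_eq_measure)
    qed
    have nn: "0 \<le> p a c" "0 \<le> q b c" "0 \<le> r c" "0 \<le> s (a, b, c)"
      by (simp_all add: p_def q_def r_def s_def)
    \<comment> \<open>Only an inequality: where \<open>s\<close> vanishes, division by zero makes
      the left side 0 while the coupling may have positive mass.\<close>
    have "p a c * q b c / (s (a, b, c) * r c) * s (a, b, c) \<le> q b c / r c * p a c"
      using nn by (cases "s (a, b, c) = 0") (auto simp: mult.commute)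
    then show "f (a, bc) * ennreal (s (a, bc)) \<le> ennreal (q (fst bc) (snd bc) / r (snd bc)) *
        emeasure M (V -` {a} \<inter> (Z -` {snd bc} \<inter> space M))"
      using nn by (simp add: bc p f_def ennreal_mult[symmetric] ennreal_leI)
  qed
  also have "\<dots> = (\<integral>\<^sup>+bc. ennreal (q (fst bc) (snd bc) / r (snd bc)) *
      emeasure M (Z -` {snd bc} \<inter> space M) \<partial>count_space UNIV)"
    by (simp add: nn_integral_cmult sum_emeasure_fibres[OF V] observable_sets[OF Z])
  also have "\<dots> \<le> (\<integral>\<^sup>+bc. emeasure M (YZ -` {bc} \<inter> space M) \<partial>count_space UNIV)"
  proof (rule nn_integral_mono)
    fix bc :: "'c \<times> 'd"
    have nn: "0 \<le> q (fst bc) (snd bc)" "0 \<le> r (snd bc)" by (simp_all add: q_def r_def)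
    have "q (fst bc) (snd bc) / r (snd bc) * r (snd bc) \<le> q (fst bc) (snd bc)" using nn by auto
    then have "ennreal (q (fst bc) (snd bc) / r (snd bc)) * ennreal (r (snd bc)) \<le> ennreal (q (fst bc) (snd bc))"
      using nn by (simp only: ennreal_mult[symmetric] divide_nonneg_nonneg ennreal_leI)
    then show "ennreal (q (fst bc) (snd bc) / r (snd bc)) * emeasure M (Z -` {snd bc} \<inter> space M)
        \<le> emeasure M (YZ -` {bc} \<inter> space M)"
      by (simp add: emeasure_eq_measure q_def r_def)
  qed
  also have "\<dots> = 1"
    using sum_emeasure_fibres[OF obs(2), of "space M"] by (simp add: emeasure_space_1)
  finally show ?thesis .
qed

text \<open>Apply \<open>- ln t \<ge> 1 - t\<close> to the ratio of the previous lemma.\<close>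

lemma obs_entropy_submodular:
  assumes V: "observable M V" and Y: "observable M Y" and Z: "observable M Z"
  shows "obs_entropy M (\<lambda>x. (V x, Y x, Z x)) + obs_entropy M Z
    \<le> obs_entropy M (\<lambda>x. (V x, Z x)) + obs_entropy M (\<lambda>x. (Y x, Z x))"
proof -
  let ?XZ = "\<lambda>x. (V x, Z x)" and ?YZ = "\<lambda>x. (Y x, Z x)" and ?XYZ = "\<lambda>x. (V x, Y x, Z x)"
  let ?I = "\<lambda>p. ennreal (- ln p)"
  let ?R = "\<lambda>x. ennreal (prob (fibre M ?XZ x) * prob (fibre M ?YZ x)
      / (prob (fibre M ?XYZ x) * prob (fibre M Z x)))"
  note XZ = observable_Pair[OF V Z] and YZ = observable_Pair[OF Y Z]
    and XYZ = observable_Pair[OF V observable_Pair[OF Y Z]]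
  note [measurable] = fibre_entropy_measurable[OF XZ] fibre_entropy_measurable[OF YZ]
    fibre_entropy_measurable[OF XYZ] fibre_entropy_measurable[OF Z]
  \<comment> \<open>The constant of the logarithm estimate is kept as \<open>+ 1\<close> on the
    left, so that all terms stay nonnegative in \<open>ennreal\<close>; it cancels at the end
    against the bound 1 for the integral of \<open>?R\<close>.\<close>
  have "obs_entropy M ?XYZ + obs_entropy M Z + 1
      = (\<integral>\<^sup>+x. ?I (prob (fibre M ?XYZ x)) + ?I (prob (fibre M Z x)) + 1 \<partial>M)"
    unfolding obs_entropy_def by (simp add: nn_integral_add emeasure_space_1)
  also have "\<dots> \<le> (\<integral>\<^sup>+x. ?I (prob (fibre M ?XZ x)) + ?I (prob (fibre M ?YZ x)) + ?R x \<partial>M)"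
  proof (rule nn_integral_mono_AE)
    show "AE x in M. ?I (prob (fibre M ?XYZ x)) + ?I (prob (fibre M Z x)) + 1
        \<le> ?I (prob (fibre M ?XZ x)) + ?I (prob (fibre M ?YZ x)) + ?R x"
      using AE_fibre_pos[OF XZ] AE_fibre_pos[OF YZ] AE_fibre_pos[OF XYZ] AE_fibre_pos[OF Z]
    proof eventually_elim
      fix x
      define p q r s where pqrs: "p = prob (fibre M ?XZ x)" "q = prob (fibre M ?YZ x)"
        "r = prob (fibre M ?XYZ x)" "s = prob (fibre M Z x)"
      assume "0 < prob (fibre M ?XZ x)" "0 < prob (fibre M ?YZ x)"
        "0 < prob (fibre M ?XYZ x)" "0 < prob (fibre M Z x)"
      then have pos: "0 < p" "0 < q" "0 < r" "0 < s" by (simp_all add: pqrs)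
      have nn: "0 \<le> - ln p" "0 \<le> - ln q" "0 \<le> - ln r" "0 \<le> - ln s"
        unfolding pqrs by (rule ln_prob_nonneg)+
      have "ln (p * q / (r * s)) \<le> p * q / (r * s) - 1"
        using pos by (intro ln_le_minus_one) simp
      then have "- ln r + - ln s + 1 \<le> - ln p + - ln q + p * q / (r * s)"
        using pos by (simp add: ln_div ln_mult)
      then have "ennreal (- ln r + - ln s + 1) \<le> ennreal (- ln p + - ln q + p * q / (r * s))"
        by (rule ennreal_leI)
      then show "?I (prob (fibre M ?XYZ x)) + ?I (prob (fibre M Z x)) + 1
        \<le> ?I (prob (fibre M ?XZ x)) + ?I (prob (fibre M ?YZ x)) + ?R x"
        unfolding pqrs[symmetric] using nn pos
        by (simp only: ennreal_plus add_nonneg_nonneg ennreal_1 zero_le_one divide_nonneg_nonneg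
            mult_nonneg_nonneg less_imp_le)
    qed
  qed
  also have "\<dots> = obs_entropy M ?XZ + obs_entropy M ?YZ + (\<integral>\<^sup>+x. ?R x \<partial>M)"
    unfolding obs_entropy_def by (simp add: nn_integral_add)
  also have "\<dots> \<le> obs_entropy M ?XZ + obs_entropy M ?YZ + 1"
    by (intro add_mono order_refl conditional_independence_ratio_le_1 V Y Z)
  finally show ?thesis by (simp add: ennreal_add_left_cancel_le add.commute)
qed

lemma obs_entropy_const: "obs_entropy M (\<lambda>x. c) = 0"
  by (simp add: obs_entropy_def fibre_def prob_space)

lemma observable_const: "observable M (\<lambda>x. c)"
  by (rule observable_determined[OF observable_indicator[of "{}"]]) (auto simp: determines_def)

text \<open>Submodularity with a constant observable as the condition.\<close>

lemma obs_entropy_Pair_le: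
  assumes V: "observable M V" and Y: "observable M Y"
  shows "obs_entropy M (\<lambda>x. (V x, Y x)) \<le> obs_entropy M V + obs_entropy M Y"
proof -
  have *: "obs_entropy M (\<lambda>x. (V x, Y x)) = obs_entropy M (\<lambda>x. (V x, Y x, ()))"
    "obs_entropy M V = obs_entropy M (\<lambda>x. (V x, ()))"
    "obs_entropy M Y = obs_entropy M (\<lambda>x. (Y x, ()))"
    by (rule obs_entropy_cong; simp)+
  show ?thesis
    using obs_entropy_submodular[OF V Y observable_const[of "()"]] by (simp add: * obs_entropy_const)
qed

text \<open>Conditional entropy decreases under refinement of the condition. The bound
  \<open>H(V | Z) \<le> e\<close> is written additively to avoid differences of possibly infinite
  terms; finiteness of the entropy of \<open>Z\<close> permits the one cancellation.\<close>

lemma conditional_entropy_antimono: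
  assumes V: "observable M V" and Z': "observable M Z'" and d: "determines M Z' Z"
    and fin: "obs_entropy M Z < \<infinity>" and le: "obs_entropy M (\<lambda>x. (V x, Z x)) \<le> obs_entropy M Z + e"
  shows "obs_entropy M (\<lambda>x. (V x, Z' x)) \<le> obs_entropy M Z' + e"
proof -
  have Z: "observable M Z" using Z' d by (rule observable_determined)
  have "obs_entropy M (\<lambda>x. (V x, Z' x, Z x)) = obs_entropy M (\<lambda>x. (V x, Z' x))"
    "obs_entropy M (\<lambda>x. (Z' x, Z x)) = obs_entropy M Z'"
    using d by (auto intro!: obs_entropy_cong simp: determines_def)
  then have "obs_entropy M (\<lambda>x. (V x, Z' x)) + obs_entropy M Z \<le> obs_entropy M Z + e + obs_entropy M Z'"
    using obs_entropy_submodular[OF V Z' Z] le by (metis (no_types, lifting) add_right_mono order_trans)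
  then have "obs_entropy M Z + obs_entropy M (\<lambda>x. (V x, Z' x)) \<le> obs_entropy M Z + (obs_entropy M Z' + e)"
    by (simp add: ac_simps)
  then show ?thesis using fin by (auto simp: ennreal_add_left_cancel_le)
qed

text \<open>The chain rule: first add \<open>Y\<close> to \<open>Z\<close> at cost
  \<open>e'\<close>, then \<open>V\<close> to the pair, where the cost \<open>e\<close> given
  \<open>Z\<close> alone is still an upper bound.\<close>

lemma conditional_entropy_Pair:
  assumes V: "observable M V" and Y: "observable M Y" and Z: "observable M Z"
    and fin: "obs_entropy M Z < \<infinity>"
    and le: "obs_entropy M (\<lambda>x. (V x, Z x)) \<le> obs_entropy M Z + e"
      "obs_entropy M (\<lambda>x. (Y x, Z x)) \<le> obs_entropy M Z + e'"
  shows "obs_entropy M (\<lambda>x. ((V x, Y x), Z x)) \<le> obs_entropy M Z + (e + e')"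
proof -
  have "obs_entropy M (\<lambda>x. (V x, (Y x, Z x))) \<le> obs_entropy M (\<lambda>x. (Y x, Z x)) + e"
    by (rule conditional_entropy_antimono[OF V observable_Pair[OF Y Z] _ fin le(1)])
      (simp add: determines_def)
  also have "\<dots> \<le> obs_entropy M Z + e' + e" using le(2) by (rule add_right_mono)
  also have "obs_entropy M (\<lambda>x. (V x, (Y x, Z x))) = obs_entropy M (\<lambda>x. ((V x, Y x), Z x))"
    by (rule obs_entropy_cong) auto
  finally show ?thesis by (simp add: ac_simps)
qed

text \<open>A crude bound on binary entropy; what matters is that it tends to 0 with the probability
  of \<open>A\<close>.\<close>

lemma obs_entropy_indicator_le:
  assumes A: "A \<in> sets M"
  shows "obs_entropy M (\<lambda>x. x \<in> A) \<le> ennreal (3 * sqrt (prob A))"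
proof -
  let ?V = "\<lambda>x. x \<in> A"
  define p where "p = prob A"
  have p: "0 \<le> p" "p \<le> 1" by (simp_all add: p_def)
  have T: "?V -` {True} \<inter> space M = A" using sets.sets_into_space[OF A] by auto
  have F: "?V -` {False} \<inter> space M = space M - A" by auto
  have "obs_entropy M ?V = (\<integral>\<^sup>+x. (\<lambda>c. ennreal (- ln (prob (?V -` {c} \<inter> space M)))) (?V x) \<partial>M)"
    by (simp add: obs_entropy_def fibre_def)
  also have "\<dots> = (\<integral>\<^sup>+c. ennreal (- ln (prob (?V -` {c} \<inter> space M))) *
      emeasure M (?V -` {c} \<inter> space M) \<partial>count_space UNIV)"
    by (rule nn_integral_observable[OF observable_indicator[OF A]])
  also have "\<dots> = (\<Sum>c\<in>UNIV. ennreal (- ln (prob (?V -` {c} \<inter> space M)) * prob (?V -` {c} \<inter> space M)))"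
    by (subst nn_integral_count_space_finite, simp, rule sum.cong[OF refl], subst ennreal_mult)
      (use ln_prob_nonneg in \<open>auto simp: emeasure_eq_measure\<close>)
  also have "\<dots> = ennreal (- ln p * p) + ennreal (- ln (1 - p) * (1 - p))"
    by (simp add: UNIV_bool T F p_def prob_compl[OF A] add.commute)
  also have "\<dots> = ennreal (- ln p * p + - ln (1 - p) * (1 - p))"
    using ln_prob_nonneg[of A] ln_prob_nonneg[of "space M - A"] p
    by (subst ennreal_plus) (auto simp: p_def prob_compl[OF A] mult_nonpos_nonneg)
  also have "\<dots> \<le> ennreal (3 * sqrt p)"
  proof (rule ennreal_leI)
    have "- ln p * p \<le> 2 * sqrt p"
    proof (cases "p = 0")
      case False
      then have pos: "0 < p" using p by simp
      \<comment> \<open>Applying the estimate at \<open>1 / sqrt p\<close> instead of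
        \<open>1 / p\<close> leaves a factor \<open>sqrt p\<close> after multiplication by
        \<open>p\<close>.\<close>
      have "ln (1 / sqrt p) \<le> 1 / sqrt p - 1" using pos by (intro ln_le_minus_one) simp
      then have "- ln p \<le> 2 / sqrt p" using pos by (simp add: ln_div ln_sqrt)
      then have "- ln p * p \<le> 2 / sqrt p * p" using p by (intro mult_right_mono) auto
      also have "\<dots> = 2 * sqrt p" using pos by (simp add: field_simps)
      finally show ?thesis .
    qed simp
    moreover have "- ln (1 - p) * (1 - p) \<le> p"
    proof (cases "p = 1")
      case False
      then have pos: "0 < 1 - p" using p by simp
      have "ln (1 / (1 - p)) \<le> 1 / (1 - p) - 1" using pos by (intro ln_le_minus_one) simp
      then have "- ln (1 - p) \<le> 1 / (1 - p) - 1" using pos by (simp add: ln_div)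
      then have "- ln (1 - p) * (1 - p) \<le> (1 / (1 - p) - 1) * (1 - p)" using pos by (intro mult_right_mono) auto
      also have "\<dots> = p" using pos by (simp add: field_simps)
      finally show ?thesis .
    qed simp
    moreover have "p \<le> sqrt p" using p by (simp add: real_le_rsqrt power2_eq_square mult_left_le)
    ultimately show "- ln p * p + - ln (1 - p) * (1 - p) \<le> 3 * sqrt p" by simp
  qed
  finally show ?thesis by (simp add: p_def)
qed

text \<open>The information function of \<open>P\<close> is the density of a finite measure
  \<open>\<nu>\<close>. The sets where \<open>P\<close> avoids the first \<open>n\<close> values
  decrease to the empty set, so their \<open>\<nu>\<close>-measure tends to 0; elsewhere truncation
  leaves the fibres unchanged.\<close>

lemma obs_entropy_truncate:
  assumes P: "observable M P" and fin: "obs_entropy M P < \<infinity>" and \<epsilon>: "0 < (\<epsilon>::ennreal)"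
  obtains F where "finite F"
    "obs_entropy M P \<le> obs_entropy M (\<lambda>x. if P x \<in> F then Some (P x) else None) + \<epsilon>"
proof -
  define \<nu> where "\<nu> = density M (\<lambda>x. ennreal (- ln (prob (fibre M P x))))"
  define F where "F n = from_nat_into (P ` space M) ` {..<n}" for n :: nat
  define U where "U n = {x \<in> space M. P x \<notin> F n}" for n
  note [measurable] = fibre_entropy_measurable[OF P]
  have U: "U n \<in> sets M" for n
  proof -
    have "U n = space M - (\<Union>c\<in>F n. P -` {c} \<inter> space M)" by (auto simp: U_def)
    moreover have "(\<Union>c\<in>F n. P -` {c} \<inter> space M) \<in> sets M"
      using P by (intro sets.finite_UN) (auto simp: F_def observable_def)
    ultimately show ?thesis by auto
  qed
  have \<nu>: "emeasure \<nu> (U n) = (\<integral>\<^sup>+x. ennreal (- ln (prob (fibre M P x))) * indicator (U n) x \<partial>M)" for n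
    unfolding \<nu>_def using U by (intro emeasure_density) auto
  have "emeasure \<nu> (U n) \<le> obs_entropy M P" for n
    unfolding \<nu> obs_entropy_def by (intro nn_integral_mono) (auto simp: indicator_def)
  then have fin': "emeasure \<nu> (U n) \<noteq> \<infinity>" for n using fin by (metis infinity_ennreal_def leD)
  have "(\<lambda>n. emeasure \<nu> (U n)) \<longlonglongrightarrow> emeasure \<nu> (\<Inter>n. U n)"
  proof (rule Lim_emeasure_decseq)
    show "range U \<subseteq> sets \<nu>" using U by (auto simp: \<nu>_def)
    show "decseq U" by (auto simp: decseq_def U_def F_def)
  qed (use fin' in simp)
  moreover have "(\<Inter>n. U n) = {}"
  proof (rule ccontr)
    assume "(\<Inter>n. U n) \<noteq> {}"
    then obtain x where x: "x \<in> U n" for n by auto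
    then have "P x \<in> P ` space M" by (auto simp: U_def)
    moreover have "countable (P ` space M)" using P by (simp add: observable_def)
    ultimately obtain k where "P x = from_nat_into (P ` space M) k"
      by (metis from_nat_into_surj)
    then have "P x \<in> F (Suc k)" by (auto simp: F_def)
    with x[of "Suc k"] show False by (simp add: U_def)
  qed
  ultimately have "(\<lambda>n. emeasure \<nu> (U n)) \<longlonglongrightarrow> 0" by simp
  then have "eventually (\<lambda>n. emeasure \<nu> (U n) < \<epsilon>) sequentially" using \<epsilon> by (rule order_tendstoD)
  then obtain n where n: "emeasure \<nu> (U n) < \<epsilon>" by (auto simp: eventually_sequentially)
  let ?Q = "\<lambda>x. if P x \<in> F n then Some (P x) else None"
  have Q: "observable M ?Q" using P by (rule observable_determined) (simp add: determines_def)
  note [measurable] = fibre_entropy_measurable[OF Q] U[of n]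
  have "obs_entropy M P \<le> (\<integral>\<^sup>+x. ennreal (- ln (prob (fibre M ?Q x))) +
      ennreal (- ln (prob (fibre M P x))) * indicator (U n) x \<partial>M)"
    unfolding obs_entropy_def
  proof (rule nn_integral_mono)
    fix x assume x: "x \<in> space M"
    show "ennreal (- ln (prob (fibre M P x))) \<le> ennreal (- ln (prob (fibre M ?Q x))) +
      ennreal (- ln (prob (fibre M P x))) * indicator (U n) x"
    proof (cases "P x \<in> F n")
      case True
      then have "fibre M ?Q x = fibre M P x" by (auto simp: fibre_def split: if_splits)
      then show ?thesis by simp
    next
      case False
      then show ?thesis using x by (simp add: U_def)
    qed
  qed
  also have "\<dots> = obs_entropy M ?Q + emeasure \<nu> (U n)"
    unfolding \<nu> obs_entropy_def by (rule nn_integral_add) auto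
  also have "\<dots> \<le> obs_entropy M ?Q + \<epsilon>" using n by (intro add_mono) auto
  finally show ?thesis using that[of "F n"] by (simp add: F_def)
qed

text \<open>
  A countable \<open>P\<close> is first truncated to finitely many values; each event \<open>P = c\<close> is then replaced by its
  difference from an approximating event that \<open>Z D\<close> determines.
\<close>

lemma conditional_entropy_small:
  fixes Z :: "'i set \<Rightarrow> 'a \<Rightarrow> 'd"
  assumes obsZ: "\<And>D. finite D \<Longrightarrow> D \<subseteq> J \<Longrightarrow> observable M (Z D) \<and> obs_entropy M (Z D) < \<infinity>"
    and monoZ: "\<And>D E. finite E \<Longrightarrow> E \<subseteq> J \<Longrightarrow> D \<subseteq> E \<Longrightarrow> determines M (Z E) (Z D)"
    and approx: "\<And>B \<epsilon>. B \<in> sets M \<Longrightarrow> 0 < \<epsilon> \<Longrightarrow> \<exists>D C. finite D \<and> D \<subseteq> J \<and> C \<in> sets M \<and>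
      determines M (Z D) (\<lambda>x. x \<in> C) \<and> prob (sym_diff B C) < \<epsilon>"
    and P: "observable M P" and fin: "obs_entropy M P < \<infinity>" and \<epsilon>: "0 < (\<epsilon>::real)"
  obtains D where "finite D" "D \<subseteq> J" "obs_entropy M (\<lambda>x. (P x, Z D x)) \<le> obs_entropy M (Z D) + ennreal \<epsilon>"
proof -
  have ind: "\<exists>D. finite D \<and> D \<subseteq> J \<and>
      obs_entropy M (\<lambda>x. (x \<in> A, Z D x)) \<le> obs_entropy M (Z D) + ennreal \<epsilon>"
    if A: "A \<in> sets M" and \<epsilon>: "0 < \<epsilon>" for A and \<epsilon> :: real
  proof -
    \<comment> \<open>The square is chosen against the bound \<open>3 * sqrt (prob ?N)\<close>,
      which then is at most \<epsilon>.\<close>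
    from approx[OF A, of "(\<epsilon> / 3)\<^sup>2"] \<epsilon> obtain D C where D: "finite D" "D \<subseteq> J" and C: "C \<in> sets M"
      "determines M (Z D) (\<lambda>x. x \<in> C)" "prob (sym_diff A C) < (\<epsilon> / 3)\<^sup>2" by auto
    let ?N = "sym_diff A C"
    have N: "?N \<in> sets M" using A C by auto
    have Z: "observable M (Z D)" using obsZ D by blast
    \<comment> \<open>\<open>Z D\<close> determines membership in \<open>C\<close>, and together
      with the symmetric difference \<open>?N\<close> this recovers membership in
      \<open>A\<close>.\<close>
    have "obs_entropy M (\<lambda>x. (x \<in> A, Z D x)) \<le> obs_entropy M (\<lambda>x. (x \<in> ?N, Z D x))"
    proof (intro obs_entropy_mono observable_Pair observable_indicator N Z)
      show "determines M (\<lambda>x. (x \<in> ?N, Z D x)) (\<lambda>x. (x \<in> A, Z D x))"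
        using C(2) unfolding determines_def prod.inject by blast
    qed
    also have "\<dots> \<le> obs_entropy M (\<lambda>x. x \<in> ?N) + obs_entropy M (Z D)"
      by (intro obs_entropy_Pair_le observable_indicator N Z)
    also have "obs_entropy M (\<lambda>x. x \<in> ?N) \<le> ennreal \<epsilon>"
    proof -
      have "sqrt (prob ?N) \<le> \<epsilon> / 3" using C(3) \<epsilon> by (intro real_le_lsqrt) auto
      then have "ennreal (3 * sqrt (prob ?N)) \<le> ennreal \<epsilon>" by (intro ennreal_leI) simp
      then show ?thesis using obs_entropy_indicator_le[OF N] by (rule order_trans[rotated])
    qed
    finally show ?thesis using D by (intro exI[of _ D]) (simp add: add.commute add_right_mono)
  qed
  define Q where "Q F x = (if P x \<in> F then Some (P x) else None)" for F x
  have Q: "observable M (Q F)" for F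
    using P by (rule observable_determined) (simp add: determines_def Q_def)
  have fin_case: "\<exists>D. finite D \<and> D \<subseteq> J \<and>
      obs_entropy M (\<lambda>x. (Q F x, Z D x)) \<le> obs_entropy M (Z D) + ennreal \<epsilon>"
    if "finite F" "0 < \<epsilon>" for F and \<epsilon> :: real
    using that
  proof (induction F arbitrary: \<epsilon> rule: finite_induct)
    case empty
    have "obs_entropy M (\<lambda>x. (Q {} x, Z {} x)) = obs_entropy M (Z {})"
      by (rule obs_entropy_cong) (simp add: Q_def)
    then show ?case by (intro exI[of _ "{}"]) simp
  next
    case (insert c F)
    let ?A = "P -` {c} \<inter> space M"
    have A: "?A \<in> sets M" using P by (rule observable_sets)
    from insert.IH[of "\<epsilon> / 2"] insert.prems obtain D1 where D1: "finite D1" "D1 \<subseteq> J"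
      "obs_entropy M (\<lambda>x. (Q F x, Z D1 x)) \<le> obs_entropy M (Z D1) + ennreal (\<epsilon> / 2)" by auto
    from ind[OF A, of "\<epsilon> / 2"] insert.prems obtain D2 where D2: "finite D2" "D2 \<subseteq> J"
      "obs_entropy M (\<lambda>x. (x \<in> ?A, Z D2 x)) \<le> obs_entropy M (Z D2) + ennreal (\<epsilon> / 2)" by auto
    let ?D = "D1 \<union> D2"
    have D: "finite ?D" "?D \<subseteq> J" using D1 D2 by auto
    have Z: "observable M (Z ?D)" "obs_entropy M (Z ?D) < \<infinity>" using obsZ[OF D] by auto
    \<comment> \<open>Admitting one more value \<open>c\<close> splits the class \<open>None\<close>
      by the event \<open>P = c\<close>, so the pair on the right determines the new
      truncation.\<close>
    have "obs_entropy M (\<lambda>x. (Q (insert c F) x, Z ?D x))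
        \<le> obs_entropy M (\<lambda>x. ((Q F x, x \<in> ?A), Z ?D x))"
      by (intro obs_entropy_mono observable_Pair observable_indicator Q A Z)
        (auto simp: determines_def Q_def split: if_splits)
    also have "\<dots> \<le> obs_entropy M (Z ?D) + (ennreal (\<epsilon> / 2) + ennreal (\<epsilon> / 2))"
    proof (rule conditional_entropy_Pair[OF Q observable_indicator[OF A] Z])
      show "obs_entropy M (\<lambda>x. (Q F x, Z ?D x)) \<le> obs_entropy M (Z ?D) + ennreal (\<epsilon> / 2)"
        using obsZ[OF D1(1,2)] monoZ[OF D, of D1] D1(3)
        by (intro conditional_entropy_antimono[OF Q Z(1), of "Z D1"]) auto
      show "obs_entropy M (\<lambda>x. (x \<in> ?A, Z ?D x)) \<le> obs_entropy M (Z ?D) + ennreal (\<epsilon> / 2)"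
        using obsZ[OF D2(1,2)] monoZ[OF D, of D2] D2(3)
        by (intro conditional_entropy_antimono[OF observable_indicator[OF A] Z(1), of "Z D2"]) auto
    qed
    also have "ennreal (\<epsilon> / 2) + ennreal (\<epsilon> / 2) = ennreal \<epsilon>"
      using insert.prems by (simp add: ennreal_plus[symmetric] del: ennreal_plus)
    finally show ?case using D by blast
  qed
  obtain F where F: "finite F" "obs_entropy M P \<le> obs_entropy M (Q F) + ennreal (\<epsilon> / 2)"
    using obs_entropy_truncate[OF P fin, of "ennreal (\<epsilon> / 2)"] \<epsilon> unfolding Q_def[abs_def] by auto
  from fin_case[OF F(1), of "\<epsilon> / 2"] \<epsilon> obtain D where D: "finite D" "D \<subseteq> J"
    "obs_entropy M (\<lambda>x. (Q F x, Z D x)) \<le> obs_entropy M (Z D) + ennreal (\<epsilon> / 2)" by auto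
  have Z: "observable M (Z D)" using obsZ D by blast
  have "obs_entropy M (Q F) \<le> obs_entropy M P"
    by (rule obs_entropy_mono[OF P]) (simp add: determines_def Q_def)
  then have QF: "obs_entropy M (Q F) < \<infinity>" using fin by (rule le_less_trans)
  \<comment> \<open>The truncation is inserted as an intermediate observable: \<open>P\<close> is
    nearly determined by \<open>Q F\<close>, and \<open>Q F\<close> nearly by \<open>Z D\<close>,
    each up to half of \<epsilon>.\<close>
  have "obs_entropy M (\<lambda>x. (P x, Z D x)) \<le> obs_entropy M (\<lambda>x. (P x, (Q F x, Z D x)))"
    by (intro obs_entropy_mono observable_Pair P Q Z) (simp add: determines_def)
  also have "\<dots> \<le> obs_entropy M (\<lambda>x. (Q F x, Z D x)) + ennreal (\<epsilon> / 2)"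
  proof (rule conditional_entropy_antimono[OF P observable_Pair[OF Q Z] _ QF])
    have "obs_entropy M (\<lambda>x. (P x, Q F x)) = obs_entropy M P"
      by (rule obs_entropy_cong) (auto simp: Q_def)
    then show "obs_entropy M (\<lambda>x. (P x, Q F x)) \<le> obs_entropy M (Q F) + ennreal (\<epsilon> / 2)"
      using F by simp
  qed (simp add: determines_def)
  also have "\<dots> \<le> obs_entropy M (Z D) + ennreal (\<epsilon> / 2) + ennreal (\<epsilon> / 2)"
    using D(3) by (rule add_right_mono)
  also have "\<dots> = obs_entropy M (Z D) + ennreal \<epsilon>"
    using \<epsilon> by (simp add: add.assoc ennreal_plus[symmetric] del: ennreal_plus)
  finally show ?thesis using that D by blast
qed

end

section \<open>Comparison of the integral form of entropy with the Shannon sum\<close>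

lemma infsum_ereal_eq_nn_integral_count_space:
  fixes f :: "'c \<Rightarrow> ennreal"
  assumes A: "countable A"
  shows "(\<Sum>\<^sub>\<infinity>a\<in>A. enn2ereal (f a)) = enn2ereal (\<integral>\<^sup>+a. f a \<partial>count_space A)"
proof (cases "finite A")
  case True
  then show ?thesis by (simp add: nn_integral_count_space_finite)
next
  case False
  \<comment> \<open>An enumeration of the infinite set \<open>A\<close> turns both sides into the
    same series over the natural numbers.\<close>
  note bij = bij_betw_from_nat_into[OF A False]
  let ?g = "\<lambda>n. f (from_nat_into A n)"
  have "(\<Sum>\<^sub>\<infinity>a\<in>A. enn2ereal (f a)) = (\<Sum>\<^sub>\<infinity>n. enn2ereal (?g n))"
    by (rule infsum_reindex_bij_betw[OF bij, symmetric])
  also have "\<dots> = suminf (\<lambda>n. enn2ereal (?g n))"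
  proof -
    have "(\<lambda>n. enn2ereal (?g n)) summable_on UNIV" by (rule nonneg_summable_on_complete) simp
    then have "((\<lambda>n. enn2ereal (?g n)) has_sum (\<Sum>\<^sub>\<infinity>n. enn2ereal (?g n))) UNIV" by simp
    then show ?thesis by (rule sums_unique[OF has_sum_imp_sums])
  qed
  also have "\<dots> = enn2ereal (\<integral>\<^sup>+n. ?g n \<partial>count_space UNIV)"
    by (simp add: nn_integral_count_space_nat)
  also have "(\<integral>\<^sup>+n. ?g n \<partial>count_space UNIV) = (\<integral>\<^sup>+a. f a \<partial>count_space A)"
    by (rule nn_integral_bij_count_space[OF bij])
  finally show ?thesis .
qed

context prob_space
begin

text \<open>The information function is constant on each fibre, so integrating it fibre by fibre
  gives the Shannon summands.\<close>

lemma shannon_entropy_fibres: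
  assumes V: "observable M V"
  shows "shannon_entropy M (fibre M V ` space M) = enn2ereal (obs_entropy M V)"
proof -
  let ?R = "V ` space M" and ?\<alpha> = "fibre M V ` space M"
  let ?\<eta> = "\<lambda>A. ennreal (- prob A * ln (prob A))"
  have bij: "bij_betw (\<lambda>c. V -` {c} \<inter> space M) ?R ?\<alpha>"
    by (auto simp: bij_betw_def inj_on_def fibre_def image_image)
  have R: "countable ?R" using V by (simp add: observable_def)
  then have "countable ((\<lambda>c. V -` {c} \<inter> space M) ` ?R)" by (rule countable_image)
  then have \<alpha>: "countable ?\<alpha>" using bij by (simp add: bij_betw_def)
  have \<eta>: "0 \<le> - prob A * ln (prob A)" for A
    using ln_prob_nonneg[of A] by (simp add: mult_nonneg_nonpos)
  have "obs_entropy M V = (\<integral>\<^sup>+x. (\<lambda>c. ennreal (- ln (prob (V -` {c} \<inter> space M)))) (V x) \<partial>M)"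
    by (simp add: obs_entropy_def fibre_def)
  also have "\<dots> = (\<integral>\<^sup>+c. ennreal (- ln (prob (V -` {c} \<inter> space M))) *
      emeasure M (V -` {c} \<inter> space M) \<partial>count_space UNIV)"
    by (rule nn_integral_observable[OF V])
  also have "\<dots> = (\<integral>\<^sup>+c. ?\<eta> (V -` {c} \<inter> space M) * indicator ?R c \<partial>count_space UNIV)"
  proof (rule nn_integral_cong)
    fix c
    have "V -` {c} \<inter> space M = {}" if "c \<notin> ?R" using that by auto
    moreover have "ennreal (- ln (prob (V -` {c} \<inter> space M))) * emeasure M (V -` {c} \<inter> space M)
        = ?\<eta> (V -` {c} \<inter> space M)"
      unfolding emeasure_eq_measure
      by (subst ennreal_mult[symmetric]) (use ln_prob_nonneg in \<open>auto simp: mult.commute\<close>)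
    ultimately show "ennreal (- ln (prob (V -` {c} \<inter> space M))) * emeasure M (V -` {c} \<inter> space M)
        = ?\<eta> (V -` {c} \<inter> space M) * indicator ?R c"
      by (cases "c \<in> ?R") simp_all
  qed
  also have "\<dots> = (\<integral>\<^sup>+c. ?\<eta> (V -` {c} \<inter> space M) \<partial>count_space ?R)"
    by (rule nn_integral_count_space_indicator[symmetric]) simp
  also have "\<dots> = (\<integral>\<^sup>+A. ?\<eta> A \<partial>count_space ?\<alpha>)"
    by (rule nn_integral_bij_count_space[OF bij])
  finally have "enn2ereal (obs_entropy M V) = (\<Sum>\<^sub>\<infinity>A\<in>?\<alpha>. enn2ereal (?\<eta> A))"
    by (simp only: infsum_ereal_eq_nn_integral_count_space[OF \<alpha>])
  then show ?thesis using \<eta> by (simp add: shannon_entropy_def)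
qed

end

section \<open>Finite index subgroups and word balls\<close>

context group
begin

text \<open>Every coset of the intersection is the intersection of a coset of \<open>K\<close> with
  a coset of \<open>L\<close>, which leaves finitely many possibilities.\<close>

lemma rcosets_Int_finite:
  assumes K: "subgroup K G" "finite (rcosets K)" and L: "subgroup L G" "finite (rcosets L)"
  shows "finite (rcosets (K \<inter> L))"
proof (rule finite_subset)
  show "rcosets (K \<inter> L) \<subseteq> (\<lambda>(c, d). c \<inter> d) ` ((rcosets K) \<times> (rcosets L))"
  proof
    fix c assume "c \<in> rcosets (K \<inter> L)"
    then obtain x where x: "x \<in> carrier G" "c = (K \<inter> L) #> x" by (auto simp: RCOSETS_def)
    have "(K \<inter> L) #> x = (K #> x) \<inter> (L #> x)"
    proof
      show "(K #> x) \<inter> (L #> x) \<subseteq> (K \<inter> L) #> x"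
      proof
        fix y assume "y \<in> (K #> x) \<inter> (L #> x)"
        then obtain k l where kl: "k \<in> K" "l \<in> L" "y = k \<otimes> x" "k \<otimes> x = l \<otimes> x"
          by (auto simp: r_coset_def)
        then have "k = l" using x K L by (metis r_cancel subgroup.mem_carrier)
        then show "y \<in> (K \<inter> L) #> x" using kl by (auto simp: r_coset_def)
      qed
    qed (auto simp: r_coset_def)
    then show "c \<in> (\<lambda>(c, d). c \<inter> d) ` ((rcosets K) \<times> (rcosets L))"
      using x by (auto simp: RCOSETS_def)
  qed
qed (use K L in simp)

text \<open>The map sending \<open>L #> x\<close> to \<open>K #> x\<close> is onto, hence injective
  by the comparison of cardinalities. All cosets of \<open>L\<close> inside \<open>K\<close>
  therefore coincide with \<open>L\<close>.\<close>

lemma subgroup_eq_of_index_le: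
  assumes K: "subgroup K G" and L: "subgroup L G" "finite (rcosets L)" and LK: "L \<subseteq> K"
    and card: "card (rcosets L) \<le> card (rcosets K)"
  shows "L = K"
proof -
  define f where "f c = K #> (SOME v. v \<in> c)" for c
  have f: "f (L #> x) = K #> x" if x: "x \<in> carrier G" for x
  proof -
    have "(SOME v. v \<in> L #> x) \<in> L #> x" using rcos_self[OF x L(1)] by (rule someI)
    then have "(SOME v. v \<in> L #> x) \<in> K #> x" using LK by (auto simp: r_coset_def)
    then show ?thesis unfolding f_def using repr_independence[OF _ x K] by simp
  qed
  have "f ` (rcosets L) = rcosets K" using f by (auto simp: RCOSETS_def image_UN)
  then have "inj_on f (rcosets L)"
    using L(2) card card_image_le[OF L(2), of f] by (intro eq_card_imp_inj_on) auto
  moreover have one: "\<one> \<in> K" "\<one> \<in> L" using K L by (auto intro: subgroup.one_closed)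
  ultimately have "L #> x = L #> \<one>" if "x \<in> K" for x
    using that f[of x] f[of \<one>] K subgroup.mem_carrier[OF K] coset_join2[OF _ K]
    by (auto simp: inj_on_def RCOSETS_def)
  then have "x \<in> L" if "x \<in> K" for x
    using that rcos_self[OF subgroup.mem_carrier[OF K that] L(1)] coset_join2[OF _ L(1), of \<one>] one
    by auto
  then show ?thesis using LK by blast
qed

text \<open>An overgroup is a union of cosets of \<open>K\<close>, and there are only finitely many
  such unions.\<close>

lemma finite_overgroups:
  assumes K: "subgroup K G" "finite (rcosets K)"
  shows "finite {L. subgroup L G \<and> K \<subseteq> L}"
proof (rule finite_subset)
  show "{L. subgroup L G \<and> K \<subseteq> L} \<subseteq> Union ` Pow (rcosets K)"
  proof
    fix L assume "L \<in> {L. subgroup L G \<and> K \<subseteq> L}"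
    then have L: "subgroup L G" "K \<subseteq> L" by auto
    have "L = \<Union> {c \<in> rcosets K. c \<subseteq> L}"
    proof
      show "L \<subseteq> \<Union> {c \<in> rcosets K. c \<subseteq> L}"
      proof
        fix x assume x: "x \<in> L"
        then have xG: "x \<in> carrier G" using L by (metis subgroup.mem_carrier)
        have "K #> x \<subseteq> L" using L x by (auto simp: r_coset_def intro: subgroup.m_closed)
        then show "x \<in> \<Union> {c \<in> rcosets K. c \<subseteq> L}"
          using rcos_self[OF xG K(1)] xG by (auto simp: RCOSETS_def)
      qed
    qed auto
    then show "L \<in> Union ` Pow (rcosets K)" by blast
  qed
qed (use K in simp)

text \<open>
  A member of maximal index would be contained in all others, as the family is closed under
  intersection; but it has only finitely many overgroups.
\<close>

lemma index_unbounded: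
  assumes inf: "infinite {K. subgroup K G \<and> finite (rcosets K) \<and> H \<subseteq> K}" (is "infinite ?\<K>")
  shows "\<exists>K. subgroup K G \<and> finite (rcosets K) \<and> H \<subseteq> K \<and> N < card (rcosets K)"
proof (rule ccontr)
  assume "\<not> ?thesis"
  then have bound: "card (rcosets K) \<le> N" if "K \<in> ?\<K>" for K
    using that not_less by blast
  obtain K0 where "K0 \<in> ?\<K>" using inf by (metis (no_types, lifting) finite.emptyI ex_in_conv)
  then obtain K where K: "K \<in> ?\<K>" and max: "\<And>L. L \<in> ?\<K> \<Longrightarrow> card (rcosets L) \<le> card (rcosets K)"
    using ex_has_greatest_nat[of "\<lambda>K. K \<in> ?\<K>" K0 "\<lambda>K. card (rcosets K)" "Suc N"]
      le_imp_less_Suc[OF bound] by blast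
  have "K \<subseteq> L" if L: "L \<in> ?\<K>" for L
  proof -
    have KL: "K \<inter> L \<in> ?\<K>"
      using K L by (auto intro: subgroups_Inter_pair rcosets_Int_finite)
    have "K \<inter> L = K"
      by (rule subgroup_eq_of_index_le) (use K KL max[OF KL] in auto)
    then show ?thesis by blast
  qed
  then have "?\<K> \<subseteq> {L. subgroup L G \<and> K \<subseteq> L}" by auto
  then show False using inf finite_overgroups[of K] K by (metis (no_types, lifting) finite_subset mem_Collect_eq)
qed

section \<open>Balls for the word length\<close>

lemma eval_letter_carrier: "S \<subseteq> carrier G \<Longrightarrow> fst l \<in> S \<Longrightarrow> eval_letter G l \<in> carrier G"
  by (auto simp: eval_letter_def)

lemma eval_word_carrier: "S \<subseteq> carrier G \<Longrightarrow> w \<in> words_over S \<Longrightarrow> eval_word G w \<in> carrier G"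
  by (induction w) (auto simp: eval_word_def words_over_def eval_letter_carrier)

lemma word_ball_carrier: "S \<subseteq> carrier G \<Longrightarrow> word_ball G S n \<subseteq> carrier G"
  by (auto simp: word_ball_def eval_word_carrier)

lemma word_ball_0: "word_ball G S 0 = {\<one>}"
proof -
  have "{w \<in> words_over S. length w \<le> 0} = {[]}" by (auto simp: words_over_def)
  then show ?thesis by (simp add: word_ball_def eval_word_def)
qed

lemma word_ball_mono: "m \<le> n \<Longrightarrow> word_ball G S m \<subseteq> word_ball G S n"
  by (auto simp: word_ball_def)

lemma one_in_word_ball: "\<one> \<in> word_ball G S n"
  using word_ball_mono[of 0 n S] by (simp add: word_ball_0)

lemma finite_word_ball: "finite S \<Longrightarrow> finite (word_ball G S n)"
proof -
  assume S: "finite S"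
  have "{w \<in> words_over S. length w \<le> n} \<subseteq> {w. set w \<subseteq> S \<times> UNIV \<and> length w \<le> n}"
    by (auto simp: words_over_def)
  moreover have "finite {w. set w \<subseteq> S \<times> (UNIV :: bool set) \<and> length w \<le> n}"
    using S by (intro finite_lists_length_le) simp
  ultimately show ?thesis unfolding word_ball_def by (intro finite_imageI) (rule finite_subset)
qed

text \<open>The new letter is split off on the left. After translation by \<open>v\<close> the
  larger ball then consists of the smaller balls around \<open>v\<close> and around its
  neighbours.\<close>

lemma word_ball_Suc:
  "word_ball G S (Suc n) = word_ball G S n \<union>
    (\<Union>l\<in>S \<times> UNIV. (\<lambda>x. eval_letter G l \<otimes> x) ` word_ball G S n)"
proof -
  have "{w \<in> words_over S. length w \<le> Suc n} = {w \<in> words_over S. length w \<le> n} \<union>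
      (\<Union>l\<in>S \<times> UNIV. (#) l ` {w \<in> words_over S. length w \<le> n})" (is "?L = ?R")
  proof
    show "?L \<subseteq> ?R"
    proof
      fix w assume w: "w \<in> ?L"
      show "w \<in> ?R"
      proof (cases w)
        case Nil
        then show ?thesis by (auto simp: words_over_def)
      next
        case (Cons l u)
        then have "fst l \<in> S" "u \<in> words_over S" "length u \<le> n"
          using w by (auto simp: words_over_def)
        then have "l \<in> S \<times> UNIV" "u \<in> {w \<in> words_over S. length w \<le> n}"
          by (auto simp: mem_Times_iff)
        then show ?thesis unfolding Cons by blast
      qed
    qed
  qed (fastforce simp: words_over_def)
  moreover have "eval_word G (l # w) = eval_letter G l \<otimes> eval_word G w" for l w
    by (simp add: eval_word_def)
  ultimately show ?thesis by (simp add: word_ball_def image_Un image_UN image_image)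
qed

lemma word_balls_exhaust:
  assumes "free_generating_set G S" "x \<in> carrier G"
  obtains n where "x \<in> word_ball G S n"
proof -
  have "x \<in> eval_word G ` {w \<in> words_over S. reduced w}"
    using assms by (simp add: free_generating_set_def bij_betw_def)
  then obtain w where "w \<in> words_over S" "x = eval_word G w" by auto
  then show ?thesis using that[of "length w"] by (auto simp: word_ball_def)
qed

end

section \<open>Families of balls and their orbit sums\<close>

context equivariant_families
begin

text \<open>The ball of radius \<open>n\<close> around \<open>v\<close>, restricted to
  \<open>J\<close>. The choice \<open>J = K\<close> is made for the partition that generates under
  \<open>K\<close>, and \<open>J = carrier G\<close> for the one that generates under
  \<open>G\<close>.\<close>

definition ball_family :: "'l \<Rightarrow> 'g set \<Rightarrow> nat \<Rightarrow> 'g \<Rightarrow> ('g \<times> 'l) set" where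
  "ball_family l J n v = ((\<lambda>x. v \<otimes> x) ` word_ball G S n \<inter> J) \<times> {l}"

lemma ball_family_cells: "v \<in> carrier G \<Longrightarrow> ball_family l J n v \<in> cells G"
  using word_ball_carrier[OF S_carrier, of n] finite_word_ball[OF finite_S, of n]
  by (auto simp: ball_family_def cells_def)

lemma ball_family_mono: "m \<le> n \<Longrightarrow> ball_family l J m v \<subseteq> ball_family l J n v"
  using word_ball_mono[of m n S] by (auto simp: ball_family_def)

text \<open>This presents an increase of the radius as one round of spreading, the situation of
  \<open>euler_round\<close>.\<close>

lemma ball_family_Suc:
  assumes v: "v \<in> carrier G"
  shows "ball_family l J (Suc n) v =
    ball_family l J n v \<union> (\<Union>m\<in>S \<times> UNIV. ball_family l J n (v \<otimes> eval_letter G m))"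
proof -
  have "(\<lambda>x. v \<otimes> x) ` word_ball G S (Suc n) = (\<lambda>x. v \<otimes> x) ` word_ball G S n \<union>
      (\<Union>m\<in>S \<times> UNIV. (\<lambda>x. v \<otimes> (eval_letter G m \<otimes> x)) ` word_ball G S n)"
    unfolding word_ball_Suc by (simp add: image_Un image_UN image_image)
  also have "(\<Union>m\<in>S \<times> UNIV. (\<lambda>x. v \<otimes> (eval_letter G m \<otimes> x)) ` word_ball G S n) =
      (\<Union>m\<in>S \<times> UNIV. (\<lambda>x. v \<otimes> eval_letter G m \<otimes> x) ` word_ball G S n)"
  proof (intro SUP_cong refl image_cong)
    fix m x assume "m \<in> S \<times> (UNIV :: bool set)" "x \<in> word_ball G S n"
    then show "v \<otimes> (eval_letter G m \<otimes> x) = v \<otimes> eval_letter G m \<otimes> x"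
      using v eval_letter_closed[of m] word_ball_carrier[OF S_carrier, of n] by (auto simp: m_assoc)
  qed
  finally show ?thesis by (auto simp: ball_family_def)
qed

lemma equivariant_ball_family:
  assumes J: "\<And>k x. k \<in> K \<Longrightarrow> x \<in> carrier G \<Longrightarrow> k \<otimes> x \<in> J \<longleftrightarrow> x \<in> J"
  shows "equivariant (ball_family l J n)"
  unfolding equivariant_def
proof (intro ballI conjI)
  fix v k assume v: "v \<in> carrier G" and k: "k \<in> K"
  have kG: "k \<in> carrier G" using k subgroup.mem_carrier[OF K] by blast
  note B = word_ball_carrier[OF S_carrier, of n]
  have "(\<lambda>x. k \<otimes> v \<otimes> x) ` word_ball G S n = (\<lambda>x. k \<otimes> x) ` (\<lambda>x. v \<otimes> x) ` word_ball G S n"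
    unfolding image_image using v kG B by (intro image_cong) (auto simp: m_assoc)
  moreover have "(\<lambda>x. k \<otimes> x) ` A \<inter> J = (\<lambda>x. k \<otimes> x) ` (A \<inter> J)" if "A \<subseteq> carrier G" for A
    using that J[OF k] by auto
  moreover have "(\<lambda>x. v \<otimes> x) ` word_ball G S n \<subseteq> carrier G" using v B by auto
  ultimately show "ball_family l J n (k \<otimes> v) = lshift G k (ball_family l J n v)"
    unfolding ball_family_def lshift_def by auto
qed (rule ball_family_cells)

lemma equivariant_ball_family_carrier: "equivariant (ball_family l (carrier G) n)"
  using subgroup.mem_carrier[OF K] by (intro equivariant_ball_family) auto

lemma equivariant_ball_family_K: "equivariant (ball_family l K n)"
proof (rule equivariant_ball_family)
  fix k x assume k: "k \<in> K" and x: "x \<in> carrier G"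
  show "k \<otimes> x \<in> K \<longleftrightarrow> x \<in> K"
  proof
    assume "k \<otimes> x \<in> K"
    then have "inv k \<otimes> (k \<otimes> x) \<in> K" using k K by (simp add: subgroup.m_closed subgroup.m_inv_closed)
    then show "x \<in> K" using k x subgroup.mem_carrier[OF K] by (simp add: m_assoc[symmetric])
  qed (use k K in \<open>simp add: subgroup.m_closed\<close>)
qed

text \<open>The family \<open>A\<close> is a passive background: only the balls spread. With empty
  \<open>A\<close> this gives monotonicity in the radius for a single partition.\<close>

lemma euler_ball_family_Suc:
  assumes A: "equivariant A" and J: "equivariant (ball_family l J n)"
  shows "euler (\<lambda>v. A v \<union> ball_family l J (Suc n) v) \<le> euler (\<lambda>v. A v \<union> ball_family l J n v)"
proof -
  let ?B = "ball_family l J n"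
  have "euler (\<lambda>v. (A v \<union> ?B v) \<union> (\<Union>m\<in>S \<times> UNIV. ?B (v \<otimes> eval_letter G m))) \<le> euler (\<lambda>v. A v \<union> ?B v)"
    using euler_round[OF equivariant_Un[OF A J] J, of "S \<times> UNIV"] by auto
  moreover have "euler (\<lambda>v. A v \<union> ball_family l J (Suc n) v) =
      euler (\<lambda>v. (A v \<union> ?B v) \<union> (\<Union>m\<in>S \<times> UNIV. ?B (v \<otimes> eval_letter G m)))"
    \<comment> \<open>The two families are known to agree only at vertices in
      \<open>carrier G\<close>, so the equality is checked inside the sums of
      \<open>euler\<close>.\<close>
    unfolding euler_def using S_carrier
    by (intro arg_cong2[of _ _ _ _ "(+)"] arg_cong2[of _ _ _ _ "(*)"] sum.cong refl coset_sum_cong)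
      (auto simp: ball_family_Suc Un_assoc subset_iff)
  ultimately show ?thesis by simp
qed

lemma euler_ball_family_antimono:
  assumes A: "equivariant A" and J: "\<And>n. equivariant (ball_family l J n)"
  shows "euler (\<lambda>v. A v \<union> ball_family l J n v) \<le> euler (\<lambda>v. A v \<union> ball_family l J 0 v)"
  by (induction n) (use euler_ball_family_Suc[OF A J] order_trans in blast)+

lemma equivariant_empty: "equivariant (\<lambda>v. {})"
  by (simp add: equivariant_def)

text \<open>Growing the radius from 0 cannot raise the sum. At radius 0 the family is a single point
  at each vertex of \<open>K\<close> and empty elsewhere, so only the trivial coset contributes to
  the vertex sum. The bound is thus independent of the index of \<open>K\<close>.\<close>

lemma euler_ball_family_K_le: "euler (ball_family l K n) \<le> h {(\<one>, l)}"
proof -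
  let ?B = "ball_family l K"
  have one: "\<one> \<in> K" using K by (rule subgroup.one_closed)
  have B0: "?B 0 v = (if v \<in> K then {(v, l)} else {})" if "v \<in> carrier G" for v
    using that by (auto simp: ball_family_def word_ball_0)
  have "euler (?B n) \<le> euler (?B 0)"
    using euler_ball_family_antimono[OF equivariant_empty equivariant_ball_family_K] by simp
  also have "\<dots> \<le> coset_sum (\<lambda>v. h (?B 0 v))"
    by (rule euler_le_coset_sum[OF equivariant_ball_family_K])
  also have "\<dots> = coset_sum (\<lambda>v. if v \<in> K then h {(\<one>, l)} else 0)"
  proof (rule coset_sum_cong)
    fix v assume v: "v \<in> carrier G"
    have "h {(v, l)} = h (lshift G v {(\<one>, l)})" using v by (simp add: lshift_def)
    also have "\<dots> = h {(\<one>, l)}" using v by (intro h_shift) auto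
    finally show "h (?B 0 v) = (if v \<in> K then h {(\<one>, l)} else 0)" using B0[OF v] by simp
  qed
  also have "\<dots> \<le> (\<Sum>c\<in>rcosets K. if c = K then h {(\<one>, l)} else 0)"
    unfolding coset_sum_def
  proof (rule sum_mono)
    fix c assume c: "c \<in> rcosets K"
    have "c = K" if "(SOME v. v \<in> c) \<in> K"
      using rep[OF c] coset_join2[OF _ K that] by simp
    then show "(if (SOME v. v \<in> c) \<in> K then h {(\<one>, l)} else 0) \<le> (if c = K then h {(\<one>, l)} else 0)"
      using h_nonneg[of "{(\<one>, l)}"] by auto
  qed
  also have "\<dots> \<le> h {(\<one>, l)}"
    using finite_index h_nonneg[of "{(\<one>, l)}"] by (simp add: sum.delta)
  finally show ?thesis .
qed

text \<open>This family is equivariant under all of \<open>G\<close>, so every coset contributes the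
  same amount and the index of \<open>K\<close> factors out.\<close>

lemma euler_ball_family_carrier:
  "euler (ball_family l (carrier G) n) = real (card (rcosets K)) *
    ((1 - 2 * real (card S)) * h (word_ball G S n \<times> {l}) +
     (\<Sum>s\<in>S. h (lshift G s (word_ball G S n \<times> {l}) \<union> word_ball G S n \<times> {l})))"
proof -
  let ?B = "word_ball G S n \<times> {l}"
  note B = word_ball_carrier[OF S_carrier, of n]
  have cells: "?B \<in> cells G" using B finite_word_ball[OF finite_S, of n] by (auto simp: cells_def)
  have fam: "ball_family l (carrier G) n v = lshift G v ?B" if "v \<in> carrier G" for v
    using that B by (auto simp: ball_family_def lshift_def)
  have shift_shift: "lshift G (v \<otimes> s) ?B = lshift G v (lshift G s ?B)" if "v \<in> carrier G" "s \<in> carrier G" for v s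
    unfolding lshift_def image_image using that B by (intro image_cong) (auto simp: m_assoc)
  have "coset_sum (\<lambda>v. h (ball_family l (carrier G) n v)) = coset_sum (\<lambda>v. h ?B)"
    using cells by (intro coset_sum_cong) (simp add: fam h_shift)
  moreover have "coset_sum (\<lambda>v. h (ball_family l (carrier G) n v \<union> ball_family l (carrier G) n (v \<otimes> s)))
      = coset_sum (\<lambda>v. h (lshift G s ?B \<union> ?B))" if "s \<in> S" for s
  proof (rule coset_sum_cong)
    fix v assume v: "v \<in> carrier G"
    have s: "s \<in> carrier G" using that S_carrier by auto
    have "ball_family l (carrier G) n v \<union> ball_family l (carrier G) n (v \<otimes> s) = lshift G v (lshift G s ?B \<union> ?B)"
      using v s by (auto simp: fam shift_shift)
    moreover have "h (lshift G v (lshift G s ?B \<union> ?B)) = h (lshift G s ?B \<union> ?B)"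
      using v s cells by (intro h_shift) simp_all
    ultimately show "h (ball_family l (carrier G) n v \<union> ball_family l (carrier G) n (v \<otimes> s)) = h (lshift G s ?B \<union> ?B)"
      by simp
  qed
  ultimately show ?thesis
    by (simp add: euler_def coset_sum_const sum_distrib_left algebra_simps)
qed

text \<open>Each element of \<open>C\<close> has a small increment over some finite
  \<open>D\<close>. The balls around \<open>v\<close> eventually contain \<open>D\<close>, and
  increments only shrink over larger sets.\<close>

lemma eventually_increment_small:
  assumes exhaust: "\<And>x. x \<in> carrier G \<Longrightarrow> \<exists>n. x \<in> word_ball G S n" and J: "J \<subseteq> carrier G"
    and approx: "\<And>i \<epsilon>. i \<in> carrier G \<times> UNIV \<Longrightarrow> 0 < \<epsilon> \<Longrightarrow>
      \<exists>D. finite D \<and> D \<subseteq> J \<times> {l} \<and> h (insert i D) \<le> h D + \<epsilon>"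
    and v: "v \<in> carrier G" and C: "C \<in> cells G" and \<epsilon>: "0 < \<epsilon>"
  shows "\<forall>\<^sub>F n in sequentially. h (ball_family l J n v \<union> C) - h (ball_family l J n v) \<le> \<epsilon>"
proof -
  let ?B = "ball_family l J"
  have C': "finite C" "C \<subseteq> carrier G \<times> UNIV" using C by (auto simp: cells_def)
  \<comment> \<open>The error is shared among the elements of \<open>C\<close>; the
    \<open>+ 1\<close> covers empty \<open>C\<close>.\<close>
  define \<delta> where "\<delta> = \<epsilon> / (real (card C) + 1)"
  have \<delta>: "0 < \<delta>" using \<epsilon> by (simp add: \<delta>_def add_nonneg_pos)
  have cover: "\<forall>\<^sub>F n in sequentially. i \<in> ?B n v" if i: "i \<in> J \<times> {l}" for i
  proof -
    obtain x where x: "i = (x, l)" "x \<in> J" using i by auto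
    then have xG: "x \<in> carrier G" using J by auto
    then obtain n where "inv v \<otimes> x \<in> word_ball G S n" using exhaust v by blast
    then have "v \<otimes> (inv v \<otimes> x) \<in> (\<lambda>x. v \<otimes> x) ` word_ball G S n" by blast
    then have "i \<in> ?B n v" using x xG v by (simp add: ball_family_def m_assoc[symmetric])
    then show ?thesis using ball_family_mono[of n _ l J v] by (auto simp: eventually_sequentially)
  qed
  have "\<forall>\<^sub>F n in sequentially. h (insert c (?B n v)) - h (?B n v) \<le> \<delta>" if c: "c \<in> C" for c
  proof -
    from approx[of c \<delta>] c C' \<delta> obtain D where D: "finite D" "D \<subseteq> J \<times> {l}" "h (insert c D) \<le> h D + \<delta>"
      by auto
    have "\<forall>\<^sub>F n in sequentially. \<forall>i\<in>D. i \<in> ?B n v"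
      using D cover by (intro eventually_ball_finite) auto
    then show ?thesis
    proof eventually_elim
      case (elim n)
      have "h (?B n v \<union> {c}) - h (?B n v) \<le> h (D \<union> {c}) - h D"
        using elim c C' v by (intro h_increment ball_family_cells) auto
      then show ?case using D(3) by simp
    qed
  qed
  then have "\<forall>\<^sub>F n in sequentially. \<forall>c\<in>C. h (insert c (?B n v)) - h (?B n v) \<le> \<delta>"
    using C' by (intro eventually_ball_finite) auto
  then show ?thesis
  proof eventually_elim
    case (elim n)
    have "h (?B n v \<union> C) - h (?B n v) \<le> (\<Sum>c\<in>C. h (insert c (?B n v)) - h (?B n v))"
      using v C by (intro h_increment_sum ball_family_cells)
    also have "\<dots> \<le> (\<Sum>c\<in>C. \<delta>)" using elim by (intro sum_mono) auto
    also have "\<dots> \<le> \<epsilon>" using \<epsilon> by (simp add: \<delta>_def field_simps)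
    finally show ?case .
  qed
qed

text \<open>One radius serves all cosets at once, because there are only finitely many.\<close>

lemma coset_sum_increment_small:
  assumes exhaust: "\<And>x. x \<in> carrier G \<Longrightarrow> \<exists>n. x \<in> word_ball G S n" and J: "J \<subseteq> carrier G"
    and approx: "\<And>i \<epsilon>. i \<in> carrier G \<times> UNIV \<Longrightarrow> 0 < \<epsilon> \<Longrightarrow>
      \<exists>D. finite D \<and> D \<subseteq> J \<times> {l} \<and> h (insert i D) \<le> h D + \<epsilon>"
    and C: "equivariant C" and \<epsilon>: "0 < \<epsilon>"
  obtains n where "coset_sum (\<lambda>v. h (ball_family l J n v \<union> C v) - h (ball_family l J n v)) \<le> \<epsilon>"
proof -
  let ?B = "ball_family l J"
  define \<delta> where "\<delta> = \<epsilon> / (real (card (rcosets K)) + 1)"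
  have \<delta>: "0 < \<delta>" using \<epsilon> by (simp add: \<delta>_def add_nonneg_pos)
  have "\<forall>\<^sub>F n in sequentially. \<forall>c\<in>rcosets K.
      h (?B n (SOME v. v \<in> c) \<union> C (SOME v. v \<in> c)) - h (?B n (SOME v. v \<in> c)) \<le> \<delta>"
    using finite_index
    by (intro eventually_ball_finite ballI)
      (auto intro!: eventually_increment_small[OF exhaust J approx] simp: rep equivariant_cells[OF C] \<delta>)
  then obtain n where n: "\<forall>c\<in>rcosets K.
      h (?B n (SOME v. v \<in> c) \<union> C (SOME v. v \<in> c)) - h (?B n (SOME v. v \<in> c)) \<le> \<delta>"
    by (auto simp: eventually_sequentially)
  have "coset_sum (\<lambda>v. h (?B n v \<union> C v) - h (?B n v)) \<le> (\<Sum>c\<in>rcosets K. \<delta>)"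
    unfolding coset_sum_def using n by (intro sum_mono) auto
  also have "\<dots> \<le> \<epsilon>" using \<epsilon> by (simp add: \<delta>_def field_simps)
  finally show ?thesis using that by blast
qed

text \<open>Passes from the family labelled \<open>a\<close>, whose orbit sum is bounded
  independently of the index, to the one labelled \<open>b\<close>. Both exchanges cost at most half
  of \<epsilon>, and in between the balls labelled \<open>b\<close> grow for free.\<close>

lemma euler_ball_family_le:
  assumes exhaust: "\<And>x. x \<in> carrier G \<Longrightarrow> \<exists>n. x \<in> word_ball G S n" and S: "S \<noteq> {}"
    and approx_K: "\<And>i \<epsilon>. i \<in> carrier G \<times> UNIV \<Longrightarrow> 0 < \<epsilon> \<Longrightarrow>
      \<exists>D. finite D \<and> D \<subseteq> K \<times> {a} \<and> h (insert i D) \<le> h D + \<epsilon>"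
    and approx_G: "\<And>i \<epsilon>. i \<in> carrier G \<times> UNIV \<Longrightarrow> 0 < \<epsilon> \<Longrightarrow>
      \<exists>D. finite D \<and> D \<subseteq> carrier G \<times> {b} \<and> h (insert i D) \<le> h D + \<epsilon>"
    and \<epsilon>: "0 < \<epsilon>"
  obtains m where "euler (ball_family b (carrier G) m) \<le> h {(\<one>, a)} + \<epsilon>"
proof -
  let ?D = "ball_family a K" and ?E = "ball_family b (carrier G)"
  note D = equivariant_ball_family_K[of a] and E = equivariant_ball_family_carrier[of b]
  have r: "0 < real (card S)" using S finite_S by (simp add: card_gt_0_iff)
  define \<delta> where "\<delta> = \<epsilon> / (4 * real (card S))"
  have \<delta>: "0 < \<delta>" "2 * real (card S) * \<delta> = \<epsilon> / 2" using \<epsilon> r by (simp_all add: \<delta>_def)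
  have small: "2 * real (card S) * q \<le> \<epsilon> / 2" if "q \<le> \<delta>" for q
    using that r unfolding \<delta>(2)[symmetric] by (intro mult_left_mono) auto
  obtain n where n: "coset_sum (\<lambda>v. h (?D n v \<union> ?E 0 v) - h (?D n v)) \<le> \<delta>"
    using coset_sum_increment_small[OF exhaust subgroup.subset[OF K] approx_K E \<delta>(1)] by blast
  \<comment> \<open>The order of choices matters: \<open>n\<close> makes \<open>?E 0\<close> nearly
    redundant over \<open>?D n\<close>, and \<open>m\<close> then makes this fixed
    \<open>?D n\<close> nearly redundant over \<open>?E m\<close>.\<close>
  obtain m where m: "coset_sum (\<lambda>v. h (?E m v \<union> ?D n v) - h (?E m v)) \<le> \<delta>"
    using coset_sum_increment_small[OF exhaust order_refl approx_G D \<delta>(1)] by blast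
  have "euler (?E m) \<le> euler (\<lambda>v. ?E m v \<union> ?D n v) + \<epsilon> / 2"
    using euler_sub_le[OF E[of m] D[of n] S] small[OF m] by simp
  also have "euler (\<lambda>v. ?E m v \<union> ?D n v) = euler (\<lambda>v. ?D n v \<union> ?E m v)"
    by (simp add: Un_commute)
  also have "\<dots> \<le> euler (\<lambda>v. ?D n v \<union> ?E 0 v)"
    by (rule euler_ball_family_antimono[OF D E])
  also have "\<dots> \<le> euler (?D n) + \<epsilon> / 2"
    using euler_add_le[OF D[of n] E[of 0] S] small[OF n] by simp
  also have "\<dots> \<le> h {(\<one>, a)} + \<epsilon> / 2"
    using euler_ball_family_K_le[of a n] by simp
  finally show ?thesis using that[of m] by simp
qed

end

section \<open>Joint names of translated partitions\<close>

text \<open>For a partition the union has exactly one member at points of the space. Outside the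
  space it is empty, so the function is total.\<close>

definition block :: "'x set set \<Rightarrow> 'x \<Rightarrow> 'x set" where
  "block \<alpha> x = \<Union> {A \<in> \<alpha>. x \<in> A}"

lemma block_eq: "partition_on U \<alpha> \<Longrightarrow> A \<in> \<alpha> \<Longrightarrow> x \<in> A \<Longrightarrow> block \<alpha> x = A"
  unfolding block_def partition_on_def disjoint_def by blast

lemma fibre_partition: "partition_on (space M) (fibre M V ` space M)"
  by (auto simp: partition_on_def disjoint_def fibre_def)

lemma block_fibre: "x \<in> space M \<Longrightarrow> block (fibre M V ` space M) x = fibre M V x"
  by (rule block_eq[OF fibre_partition]) (auto simp: fibre_def)

lemma fibre_block:
  assumes "partition_on (space M) \<alpha>" "x \<in> space M"
  shows "fibre M (block \<alpha>) x = block \<alpha> x"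
proof -
  obtain A where A: "A \<in> \<alpha>" "x \<in> A" using assms by (auto simp: partition_on_def)
  have "y \<in> A \<longleftrightarrow> block \<alpha> y = A" if y: "y \<in> space M" for y
  proof -
    obtain B where B: "B \<in> \<alpha>" "y \<in> B" using assms y by (auto simp: partition_on_def)
    show ?thesis using block_eq[OF assms(1) B] block_eq[OF assms(1) A(1)] B by auto
  qed
  moreover have "A \<subseteq> space M" using assms A by (auto simp: partition_on_def)
  ultimately show ?thesis using block_eq[OF assms(1) A] by (auto simp: fibre_def)
qed

lemma fibre_block_image:
  assumes "partition_on (space M) \<alpha>"
  shows "fibre M (block \<alpha>) ` space M = \<alpha>"
proof -
  have "fibre M (block \<alpha>) ` space M = block \<alpha> ` space M"
    by (intro image_cong refl fibre_block assms)
  also have "\<dots> = \<alpha>"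
  proof
    show "block \<alpha> ` space M \<subseteq> \<alpha>"
    proof
      fix B assume "B \<in> block \<alpha> ` space M"
      then obtain x where x: "x \<in> space M" "B = block \<alpha> x" by auto
      then obtain A where A: "A \<in> \<alpha>" "x \<in> A" using assms by (auto simp: partition_on_def)
      then show "B \<in> \<alpha>" using x block_eq[OF assms A] by simp
    qed
    show "\<alpha> \<subseteq> block \<alpha> ` space M"
    proof
      fix A assume A: "A \<in> \<alpha>"
      then have "A \<noteq> {}" "A \<subseteq> space M" using assms by (auto simp: partition_on_def)
      then obtain x where "x \<in> A" "x \<in> space M" by auto
      then show "A \<in> block \<alpha> ` space M" using block_eq[OF assms A] by force
    qed
  qed
  finally show ?thesis .
qed

lemma observable_block:
  assumes "countable_partition M \<alpha>"
  shows "observable M (block \<alpha>)"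
  unfolding observable_def
proof (intro conjI allI)
  have part: "partition_on (space M) \<alpha>" and sets: "\<alpha> \<subseteq> sets M"
    using assms by (auto simp: countable_partition_def)
  have "block \<alpha> ` space M = fibre M (block \<alpha>) ` space M"
    by (intro image_cong refl fibre_block[symmetric] part)
  then have img: "block \<alpha> ` space M = \<alpha>" by (simp add: fibre_block_image[OF part])
  then show "countable (block \<alpha> ` space M)" using assms by (simp add: countable_partition_def)
  fix A
  show "block \<alpha> -` {A} \<inter> space M \<in> sets M"
  proof (cases "block \<alpha> -` {A} \<inter> space M = {}")
    case False
    then obtain x where x: "x \<in> space M" "block \<alpha> x = A" by auto
    then have "block \<alpha> -` {A} \<inter> space M = A" using fibre_block[OF part x(1)] by (simp add: fibre_def)
    moreover have "A \<in> \<alpha>" using x img by auto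
    ultimately show ?thesis using sets by auto
  qed simp
qed

text \<open>A nonempty intersection of one block from each partition is pinned down by any of its
  points \<open>x\<close>: every selected block must be the fibre through \<open>x\<close>. Any
  \<open>W\<close> that separates points exactly as the tuple of all \<open>V i\<close> does is
  allowed.\<close>

lemma common_refinement_fibres:
  assumes I: "I \<noteq> {}"
    and W: "\<And>x y. x \<in> space M \<Longrightarrow> y \<in> space M \<Longrightarrow> W x = W y \<longleftrightarrow> (\<forall>i\<in>I. V i x = V i y)"
  shows "common_refinement ((\<lambda>i. fibre M (V i) ` space M) ` I) = fibre M W ` space M"
proof -
  let ?P = "(\<lambda>i. fibre M (V i) ` space M) ` I"
  have fib: "(\<Inter>i\<in>I. fibre M (V i) x) = fibre M W x" if "x \<in> space M" for x
    using I W[OF _ that] by (auto simp: fibre_def)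
  show ?thesis
  proof
    show "common_refinement ?P \<subseteq> fibre M W ` space M"
    proof
      fix A assume "A \<in> common_refinement ?P"
      then obtain f where f: "\<And>P. P \<in> ?P \<Longrightarrow> f P \<in> P" and A: "A = \<Inter> (f ` ?P)" and "A \<noteq> {}"
        by (auto simp: common_refinement)
      then obtain x where x: "x \<in> A" by auto
      have sub: "f (fibre M (V i) ` space M) \<subseteq> space M" if "i \<in> I" for i
        using f[of "fibre M (V i) ` space M"] that by (auto simp: fibre_def)
      have xs: "x \<in> space M" using I sub x A by fast
      have "f (fibre M (V i) ` space M) = fibre M (V i) x" if i: "i \<in> I" for i
      proof -
        have "f (fibre M (V i) ` space M) \<in> fibre M (V i) ` space M" "x \<in> f (fibre M (V i) ` space M)"
          using f i x A by auto
        then show ?thesis using block_eq[OF fibre_partition] block_fibre[OF xs] by metis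
      qed
      then have "A = fibre M W x" using fib[OF xs] by (simp add: A image_image)
      then show "A \<in> fibre M W ` space M" using xs by simp
    qed
    show "fibre M W ` space M \<subseteq> common_refinement ?P"
    proof
      fix A assume "A \<in> fibre M W ` space M"
      then obtain x where x: "x \<in> space M" "A = fibre M W x" by auto
      \<comment> \<open>The selector that picks from every partition the block containing
        \<open>x\<close>.\<close>
      let ?f = "\<lambda>P. block P x"
      have "?f \<in> (\<Pi> P\<in>?P. P)"
        using x(1) by (auto simp: block_fibre)
      moreover have "A = \<Inter> (?f ` ?P)"
        using x fib[OF x(1)] by (simp add: image_image block_fibre)
      moreover have "A \<noteq> {}" using x by (auto simp: fibre_def)
      ultimately show "A \<in> common_refinement ?P"
        unfolding common_refinement by (intro DiffI UN_I[of ?f]) simp_all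
    qed
  qed
qed

section \<open>Invariance of entropy under measure preserving maps\<close>

context prob_space
begin

lemma observable_compose:
  assumes V: "observable M V" and T: "T \<in> measurable M M"
  shows "observable M (\<lambda>x. V (T x))"
  unfolding observable_def
proof (intro conjI allI)
  have "(\<lambda>x. V (T x)) ` space M \<subseteq> V ` space M" using measurable_space[OF T] by auto
  then show "countable ((\<lambda>x. V (T x)) ` space M)"
    by (rule countable_subset) (use V in \<open>simp add: observable_def\<close>)
  fix c
  have "(\<lambda>x. V (T x)) -` {c} \<inter> space M = T -` (V -` {c} \<inter> space M) \<inter> space M"
    using measurable_space[OF T] by auto
  then show "(\<lambda>x. V (T x)) -` {c} \<inter> space M \<in> sets M"
    using measurable_sets[OF T observable_sets[OF V]] by simp
qed

text \<open>Fibres of the composition are preimages of fibres of \<open>V\<close>, so they have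
  equal probability; a change of variables does the rest.\<close>

lemma obs_entropy_compose:
  assumes V: "observable M V" and T: "T \<in> measurable M M" "distr M M T = M"
  shows "obs_entropy M (\<lambda>x. V (T x)) = obs_entropy M V"
proof -
  note [measurable] = fibre_entropy_measurable[OF V] T(1)
  have fib: "prob (fibre M (\<lambda>x. V (T x)) x) = prob (fibre M V (T x))" if x: "x \<in> space M" for x
  proof -
    have "fibre M (\<lambda>x. V (T x)) x = T -` fibre M V (T x) \<inter> space M"
      using measurable_space[OF T(1)] by (auto simp: fibre_def)
    then have "prob (fibre M (\<lambda>x. V (T x)) x) = measure (distr M M T) (fibre M V (T x))"
      by (simp only: measure_distr[OF T(1) observable_fibre[OF V]])
    then show ?thesis by (simp add: T)
  qed
  have "obs_entropy M (\<lambda>x. V (T x)) = (\<integral>\<^sup>+x. ennreal (- ln (prob (fibre M V (T x)))) \<partial>M)"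
    unfolding obs_entropy_def by (intro nn_integral_cong) (simp add: fib)
  also have "\<dots> = (\<integral>\<^sup>+x. ennreal (- ln (prob (fibre M V x))) \<partial>distr M M T)"
    by (subst nn_integral_distr) auto
  finally show ?thesis by (simp add: T obs_entropy_def)
qed

end

section \<open>Joint entropy of translates as a submodular function\<close>

locale partitioned_action = prob_space M for M :: "'x measure" +
  fixes G :: "('g, 'b) monoid_scheme" (structure)
    and \<phi> :: "'g \<Rightarrow> 'x \<Rightarrow> 'x" and P :: "'l \<Rightarrow> 'x set set"
  assumes group: "group G" and pmp: "pmp_action G M \<phi>"
    and partition: "countable_partition M (P l)"
    and finite_entropy: "shannon_entropy M (P l) < \<infinity>"
begin

sublocale group G by (rule group)

text \<open>The point \<open>x\<close> lies in the \<open>g\<close>-translate of a block exactly if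
  the inverse of \<open>g\<close> moves it into the block. The coordinate thus has the translated
  partition as its fibres, although its values are untranslated blocks.\<close>

definition coord :: "'g \<times> 'l \<Rightarrow> 'x \<Rightarrow> 'x set" where
  "coord i x = block (P (snd i)) (\<phi> (inv (fst i)) x)"

text \<open>The tuple of coordinates over \<open>D\<close>. Restriction fixes the value outside
  \<open>D\<close>, so that equality of names only concerns \<open>D\<close>.\<close>

definition name :: "('g \<times> 'l) set \<Rightarrow> 'x \<Rightarrow> 'g \<times> 'l \<Rightarrow> 'x set" where
  "name D x = restrict (\<lambda>i. coord i x) D"

definition h :: "('g \<times> 'l) set \<Rightarrow> real" where
  "h D = enn2real (obs_entropy M (name D))"

lemma act: "group_action G (space M) \<phi>"
  using pmp by (simp add: pmp_action_def)

lemma act_measurable: "g \<in> carrier G \<Longrightarrow> \<phi> g \<in> measurable M M"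
  and act_distr: "g \<in> carrier G \<Longrightarrow> distr M M (\<phi> g) = M"
  using pmp by (auto simp: pmp_action_def)

lemma act_space: "g \<in> carrier G \<Longrightarrow> x \<in> space M \<Longrightarrow> \<phi> g x \<in> space M"
  using group_action.element_image[OF act] by blast

lemma act_mult: "g \<in> carrier G \<Longrightarrow> k \<in> carrier G \<Longrightarrow> x \<in> space M \<Longrightarrow> \<phi> (g \<otimes> k) x = \<phi> g (\<phi> k x)"
  using group_action.composition_rule[OF act] by blast

lemma act_inv [simp]:
  assumes "g \<in> carrier G" "x \<in> space M"
  shows "\<phi> (inv g) (\<phi> g x) = x" "\<phi> g (\<phi> (inv g) x) = x"
  using group_action.orbit_sym_aux[OF act, of g x "\<phi> g x"]
    group_action.orbit_sym_aux[OF act, of "inv g" x "\<phi> (inv g) x"] assms by auto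

lemma act_one [simp]: "x \<in> space M \<Longrightarrow> \<phi> \<one> x = x"
  using act_inv(1)[of \<one> x] act_mult[of \<one> \<one> x] by simp

lemma act_image:
  assumes g: "g \<in> carrier G" and A: "A \<subseteq> space M"
  shows "\<phi> g ` A = \<phi> (inv g) -` A \<inter> space M"
proof
  show "\<phi> g ` A \<subseteq> \<phi> (inv g) -` A \<inter> space M" using g A act_space by auto
  show "\<phi> (inv g) -` A \<inter> space M \<subseteq> \<phi> g ` A"
  proof
    fix y assume y: "y \<in> \<phi> (inv g) -` A \<inter> space M"
    then have "y = \<phi> g (\<phi> (inv g) y)" using g by simp
    then show "y \<in> \<phi> g ` A" using y by blast
  qed
qed

lemma partition_P: "partition_on (space M) (P l)"
  using partition by (simp add: countable_partition_def)

lemma observable_coord: "fst i \<in> carrier G \<Longrightarrow> observable M (coord i)"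
  unfolding coord_def
  by (rule observable_compose[OF observable_block[OF partition] act_measurable]) simp

lemma obs_entropy_coord: "fst i \<in> carrier G \<Longrightarrow> obs_entropy M (coord i) < \<infinity>"
proof -
  assume i: "fst i \<in> carrier G"
  have "obs_entropy M (coord i) = obs_entropy M (block (P (snd i)))"
    unfolding coord_def
    by (rule obs_entropy_compose[OF observable_block[OF partition] act_measurable act_distr])
      (use i in simp_all)
  moreover have "enn2ereal (obs_entropy M (block (P (snd i)))) < \<infinity>"
    using finite_entropy[of "snd i"] shannon_entropy_fibres[OF observable_block[OF partition], of "snd i"]
    by (simp add: fibre_block_image[OF partition_P])
  ultimately show ?thesis by (simp add: less_top[symmetric])
qed

lemma name_eq_iff: "name D x = name D y \<longleftrightarrow> (\<forall>i\<in>D. coord i x = coord i y)"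
proof
  show "\<forall>i\<in>D. coord i x = coord i y" if eq: "name D x = name D y"
    using fun_cong[OF eq] by (simp add: name_def) metis
  show "name D x = name D y" if "\<forall>i\<in>D. coord i x = coord i y"
    unfolding name_def using that by (intro restrict_ext) simp
qed

lemma determines_name: "D \<subseteq> E \<Longrightarrow> determines M (name E) (name D)"
  unfolding determines_def name_eq_iff by blast

lemma name_empty: "name {} = (\<lambda>x. \<lambda>i. undefined)"
  by (simp add: name_def fun_eq_iff)

lemma observable_name:
  assumes "D \<in> cells G"
  shows "observable M (name D) \<and> obs_entropy M (name D) < \<infinity>"
proof -
  have "finite D" "D \<subseteq> carrier G \<times> UNIV" using assms by (auto simp: cells_def)
  then show ?thesis
  proof (induction D rule: finite_induct)
    case empty
    show ?case by (simp add: name_empty observable_const obs_entropy_const)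
  next
    case (insert i D)
    then have "fst i \<in> carrier G" by auto
    then have i: "observable M (coord i)" "obs_entropy M (coord i) < \<infinity>"
      by (rule observable_coord, rule obs_entropy_coord)
    have D: "observable M (name D)" "obs_entropy M (name D) < \<infinity>" using insert by auto
    have det: "determines M (\<lambda>x. (coord i x, name D x)) (name (insert i D))"
      unfolding determines_def prod.inject name_eq_iff by blast
    have "obs_entropy M (name (insert i D)) \<le> obs_entropy M (\<lambda>x. (coord i x, name D x))"
      by (intro obs_entropy_mono observable_Pair i D det)
    also have "\<dots> \<le> obs_entropy M (coord i) + obs_entropy M (name D)"
      by (intro obs_entropy_Pair_le i D)
    also have "\<dots> < \<infinity>" using i D by simp
    finally show ?case
      using observable_determined[OF observable_Pair[OF i(1) D(1)] det] by simp
  qed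
qed

lemma ennreal_h: "D \<in> cells G \<Longrightarrow> ennreal (h D) = obs_entropy M (name D)"
  unfolding h_def using observable_name[of D] by (intro ennreal_enn2real) simp

lemma h_ge_0: "0 \<le> h D"
  by (simp add: h_def)

text \<open>Since \<open>inv (g \<otimes> k) = inv k \<otimes> inv g\<close>, shifting the indices
  by \<open>g\<close> has the same effect as moving the point by \<open>inv g\<close>.\<close>

lemma name_lshift:
  assumes g: "g \<in> carrier G" and D: "D \<in> cells G" and x: "x \<in> space M" and y: "y \<in> space M"
  shows "name (lshift G g D) x = name (lshift G g D) y \<longleftrightarrow> name D (\<phi> (inv g) x) = name D (\<phi> (inv g) y)"
proof -
  have "coord (g \<otimes> k, l) z = coord (k, l) (\<phi> (inv g) z)" if "k \<in> carrier G" "z \<in> space M" for k l z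
    using that g by (simp add: coord_def inv_mult_group act_mult)
  moreover have "fst i \<in> carrier G" if "i \<in> D" for i using D that by (auto simp: cells_def)
  ultimately have "coord (g \<otimes> fst i, snd i) z = coord i (\<phi> (inv g) z)" if "i \<in> D" "z \<in> space M" for i z
    using that by (metis prod.collapse)
  then show ?thesis
    using x y by (simp add: name_eq_iff lshift_def case_prod_beta)
qed

sublocale submodular_entropy G h
proof
  show "h {} = 0"
    by (simp add: h_def name_empty obs_entropy_const)
next
  fix A B :: "('g \<times> 'l) set" assume B: "B \<in> cells G" and A: "A \<subseteq> B"
  have "ennreal (h A) \<le> ennreal (h B)"
    using observable_name[OF B] determines_name[OF A] A B
    by (simp add: ennreal_h cells_subset obs_entropy_mono)
  then show "h A \<le> h B" by (simp add: h_ge_0)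
next
  fix A B :: "('g \<times> 'l) set" assume A: "A \<in> cells G" and B: "B \<in> cells G"
  let ?C = "A \<inter> B"
  have C: "?C \<in> cells G" using A by (rule cells_subset) simp
  \<comment> \<open>With the name over \<open>?C\<close> as the condition, the conditional
    inequality for observables becomes submodularity for index sets.\<close>
  have "obs_entropy M (name (A \<union> B)) = obs_entropy M (\<lambda>x. (name A x, name B x, name ?C x))"
    "obs_entropy M (name A) = obs_entropy M (\<lambda>x. (name A x, name ?C x))"
    "obs_entropy M (name B) = obs_entropy M (\<lambda>x. (name B x, name ?C x))"
    by (rule obs_entropy_cong; auto simp: name_eq_iff)+
  then have "obs_entropy M (name (A \<union> B)) + obs_entropy M (name ?C) \<le> obs_entropy M (name A) + obs_entropy M (name B)"
    using obs_entropy_submodular[of "name A" "name B" "name ?C"] observable_name A B C by simp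
  then have "ennreal (h (A \<union> B) + h ?C) \<le> ennreal (h A + h B)"
    using A B C by (simp add: ennreal_h h_ge_0)
  then show "h (A \<union> B) + h ?C \<le> h A + h B"
    by (subst (asm) ennreal_le_iff) (simp_all add: h_ge_0)
next
  fix g and A :: "('g \<times> 'l) set" assume g: "g \<in> carrier G" and A: "A \<in> cells G"
  have "obs_entropy M (name (lshift G g A)) = obs_entropy M (\<lambda>x. name A (\<phi> (inv g) x))"
    using name_lshift[OF g A] by (rule obs_entropy_cong)
  also have "\<dots> = obs_entropy M (name A)"
    using observable_name[OF A] g by (intro obs_entropy_compose act_measurable act_distr) auto
  finally show "h (lshift G g A) = h A" by (simp add: h_def)
qed

section \<open>Approximation of events by finitely many coordinates\<close>

definition approximable :: "('g \<times> 'l) set \<Rightarrow> 'x set \<Rightarrow> bool" where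
  "approximable J B \<longleftrightarrow> B \<in> sets M \<and> (\<forall>\<epsilon>>0. \<exists>D C. finite D \<and> D \<subseteq> J \<and> C \<in> sets M \<and>
    determines M (name D) (\<lambda>x. x \<in> C) \<and> prob (sym_diff B C) < \<epsilon>)"

lemma approximable_sets: "approximable J B \<Longrightarrow> B \<in> sets M"
  by (simp add: approximable_def)

lemma approximableE:
  assumes "approximable J B" "0 < \<epsilon>"
  obtains D C where "finite D" "D \<subseteq> J" "C \<in> sets M" "determines M (name D) (\<lambda>x. x \<in> C)"
    "prob (sym_diff B C) < \<epsilon>"
  using assms unfolding approximable_def by blast

lemma approximableI:
  assumes "B \<in> sets M"
    and "\<And>\<epsilon>. 0 < \<epsilon> \<Longrightarrow> \<exists>D C. finite D \<and> D \<subseteq> J \<and> C \<in> sets M \<and>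
      determines M (name D) (\<lambda>x. x \<in> C) \<and> prob (sym_diff B C) < \<epsilon>"
  shows "approximable J B"
  using assms unfolding approximable_def by blast

lemma approximable_empty: "approximable J {}"
proof (rule approximableI)
  show "\<exists>D C. finite D \<and> D \<subseteq> J \<and> C \<in> sets M \<and> determines M (name D) (\<lambda>x. x \<in> C) \<and>
      prob (sym_diff {} C) < \<epsilon>" if "0 < \<epsilon>" for \<epsilon>
    using that by (intro exI[of _ "{}"]) (simp add: determines_def)
qed simp

lemma approximable_Compl:
  assumes B: "approximable J B"
  shows "approximable J (space M - B)"
proof (rule approximableI)
  show "space M - B \<in> sets M" using approximable_sets[OF B] by (rule sets.compl_sets)
  fix \<epsilon> :: real assume "0 < \<epsilon>"
  with B obtain D C where D: "finite D" "D \<subseteq> J" and C: "C \<in> sets M"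
    and det: "determines M (name D) (\<lambda>x. x \<in> C)" and small: "prob (sym_diff B C) < \<epsilon>"
    by (rule approximableE)
  have "B \<subseteq> space M" "C \<subseteq> space M"
    using approximable_sets[OF B] C sets.sets_into_space by blast+
  then have "sym_diff (space M - B) (space M - C) = sym_diff B C" by blast
  moreover have "determines M (name D) (\<lambda>x. x \<in> space M - C)"
    using det unfolding determines_def by blast
  ultimately show "\<exists>D C. finite D \<and> D \<subseteq> J \<and> C \<in> sets M \<and> determines M (name D) (\<lambda>x. x \<in> C) \<and>
      prob (sym_diff (space M - B) C) < \<epsilon>"
    using D small sets.compl_sets[OF C] by (intro exI[of _ D] exI[of _ "space M - C"]) metis
qed

text \<open>Half of the error pays for cutting the union off after \<open>n\<close> sets, the other
  half for approximating these \<open>n\<close> sets separately.\<close>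

lemma approximable_UN:
  fixes B :: "nat \<Rightarrow> 'x set"
  assumes B: "\<And>i. approximable J (B i)"
  shows "approximable J (\<Union>i. B i)"
proof (rule approximableI)
  note Bs = approximable_sets[OF B]
  show UB: "(\<Union>i. B i) \<in> sets M" using Bs by blast
  fix \<epsilon> :: real assume \<epsilon>: "0 < \<epsilon>"
  define U where "U n = (\<Union>i<n. B i)" for n
  have U: "U n \<in> sets M" for n using Bs by (auto simp: U_def)
  have UN: "(\<Union>n. U n) = (\<Union>i. B i)" by (auto simp: U_def)
  have U_sub: "U n \<subseteq> (\<Union>i. B i)" for n by (auto simp: U_def)
  have "incseq U" unfolding incseq_def U_def by (intro allI impI UN_mono) auto
  then have "(\<lambda>n. prob (U n)) \<longlonglongrightarrow> prob (\<Union>n. U n)"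
    using U by (intro finite_Lim_measure_incseq) auto
  then have "eventually (\<lambda>n. prob (\<Union>i. B i) - \<epsilon> / 2 < prob (U n)) sequentially"
    unfolding UN by (rule order_tendstoD) (use \<epsilon> in simp)
  then obtain n where n: "prob (\<Union>i. B i) - \<epsilon> / 2 < prob (U n)" by (auto simp: eventually_sequentially)
  define \<delta> where "\<delta> = \<epsilon> / (2 * (real n + 1))"
  have \<delta>: "0 < \<delta>" using \<epsilon> by (simp add: \<delta>_def)
  have "\<exists>D C. finite D \<and> D \<subseteq> J \<and> C \<in> sets M \<and>
      determines M (name D) (\<lambda>x. x \<in> C) \<and> prob (sym_diff (B i) C) < \<delta>" for i
    using B[of i] \<delta> unfolding approximable_def by blast
  then obtain D C where D: "\<And>i. finite (D i)" "\<And>i. D i \<subseteq> J" and C: "\<And>i. C i \<in> sets M"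
    and det: "\<And>i. determines M (name (D i)) (\<lambda>x. x \<in> C i)"
    and small: "\<And>i. prob (sym_diff (B i) (C i)) < \<delta>"
    by metis
  let ?D = "\<Union>i<n. D i" and ?C = "\<Union>i<n. C i"
  have sd: "sym_diff (B i) (C i) \<in> sets M" for i using Bs C by blast
  have diff: "(\<Union>i. B i) - U n \<in> sets M" using UB U by blast
  have sdU: "(\<Union>i<n. sym_diff (B i) (C i)) \<in> sets M"
    using sd by (intro sets.finite_UN) auto
  have "sym_diff (\<Union>i. B i) ?C \<subseteq> ((\<Union>i. B i) - U n) \<union> (\<Union>i<n. sym_diff (B i) (C i))"
    unfolding U_def by blast
  then have "prob (sym_diff (\<Union>i. B i) ?C) \<le> prob (((\<Union>i. B i) - U n) \<union> (\<Union>i<n. sym_diff (B i) (C i)))"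
    using diff sdU by (intro finite_measure_mono sets.Un)
  also have "\<dots> \<le> prob ((\<Union>i. B i) - U n) + prob (\<Union>i<n. sym_diff (B i) (C i))"
    using diff sdU by (intro measure_Un_le)
  also have "prob ((\<Union>i. B i) - U n) = prob (\<Union>i. B i) - prob (U n)"
    using UB U U_sub by (rule finite_measure_Diff)
  also have "prob (\<Union>i<n. sym_diff (B i) (C i)) \<le> (\<Sum>i<n. prob (sym_diff (B i) (C i)))"
    using sd by (intro measure_UNION_le) auto
  also have "\<dots> \<le> (\<Sum>i<n. \<delta>)" using small by (intro sum_mono less_imp_le)
  also have "\<dots> \<le> \<epsilon> / 2" using \<epsilon> by (simp add: \<delta>_def field_simps)
  finally have total: "prob (sym_diff (\<Union>i. B i) ?C) < \<epsilon>" using n by simp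
  have "determines M (name ?D) (\<lambda>x. x \<in> ?C)"
    unfolding determines_def
  proof (intro ballI impI)
    fix x y assume xy: "x \<in> space M" "y \<in> space M" "name ?D x = name ?D y"
    have "x \<in> C i \<longleftrightarrow> y \<in> C i" if "i < n" for i
    proof -
      have "name (D i) x = name (D i) y" using xy(3) that unfolding name_eq_iff by blast
      then show ?thesis using det[of i] xy(1,2) unfolding determines_def by blast
    qed
    then show "(x \<in> ?C) = (y \<in> ?C)" by blast
  qed
  moreover have "finite ?D" "?D \<subseteq> J" using D by auto
  moreover have "?C \<in> sets M" using C by (intro sets.finite_UN) auto
  ultimately show "\<exists>D C. finite D \<and> D \<subseteq> J \<and> C \<in> sets M \<and> determines M (name D) (\<lambda>x. x \<in> C) \<and>
      prob (sym_diff (\<Union>i. B i) C) < \<epsilon>"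
    using total by (intro exI[of _ ?D] exI[of _ ?C] conjI)
qed

lemma approximable_partition:
  assumes J: "(\<one>, l) \<in> J" and A: "A \<in> P l"
  shows "approximable J A"
proof (rule approximableI)
  show As: "A \<in> sets M" using A partition[of l] by (auto simp: countable_partition_def)
  have "x \<in> A \<longleftrightarrow> coord (\<one>, l) x = A" if x: "x \<in> space M" for x
  proof -
    have "x \<in> block (P l) x" using fibre_block[OF partition_P x, of l] x by (auto simp: fibre_def)
    then show ?thesis using x block_eq[OF partition_P A, of x] by (auto simp: coord_def)
  qed
  then have det: "determines M (name {(\<one>, l)}) (\<lambda>x. x \<in> A)"
    by (simp add: determines_def name_eq_iff)
  show "\<exists>D C. finite D \<and> D \<subseteq> J \<and> C \<in> sets M \<and> determines M (name D) (\<lambda>x. x \<in> C) \<and>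
      prob (sym_diff A C) < \<epsilon>" if "0 < \<epsilon>" for \<epsilon>
    using that As J det by (intro exI[of _ "{(\<one>, l)}"] exI[of _ A]) simp
qed

lemma act_image_sets:
  assumes k: "k \<in> carrier G" and A: "A \<in> sets M"
  shows "\<phi> k ` A \<in> sets M" and "prob (\<phi> k ` A) = prob A"
proof -
  have img: "\<phi> k ` A = \<phi> (inv k) -` A \<inter> space M"
    using k sets.sets_into_space[OF A] by (rule act_image)
  show "\<phi> k ` A \<in> sets M"
    unfolding img using k A by (intro measurable_sets[OF act_measurable]) simp_all
  have "prob (\<phi> k ` A) = measure (distr M M (\<phi> (inv k))) A"
    unfolding img using A k by (intro measure_distr[symmetric] act_measurable) simp_all
  then show "prob (\<phi> k ` A) = prob A" using k by (simp add: act_distr)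
qed

text \<open>The index set \<open>D\<close> is shifted along with the event. It stays inside
  \<open>K \<times> {l}\<close> because \<open>k\<close> lies in the subgroup, and the error is
  unchanged because the action preserves the measure.\<close>

lemma approximable_image:
  assumes K: "subgroup K G" and k: "k \<in> K" and B: "approximable (K \<times> {l}) B"
  shows "approximable (K \<times> {l}) (\<phi> k ` B)"
proof (rule approximableI)
  have kG: "k \<in> carrier G" using K k by (rule subgroup.mem_carrier)
  note Bs = approximable_sets[OF B]
  show "\<phi> k ` B \<in> sets M" using kG Bs by (rule act_image_sets)
  fix \<epsilon> :: real assume "0 < \<epsilon>"
  with B obtain D C where D: "finite D" "D \<subseteq> K \<times> {l}" and C: "C \<in> sets M"
    and det: "determines M (name D) (\<lambda>x. x \<in> C)" and small: "prob (sym_diff B C) < \<epsilon>"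
    by (rule approximableE)
  have cell: "D \<in> cells G" using D subgroup.subset[OF K] by (auto simp: cells_def)
  have sd: "sym_diff B C \<in> sets M" using Bs C by blast
  have sub: "B \<subseteq> space M" "C \<subseteq> space M" "sym_diff B C \<subseteq> space M"
    using Bs C sets.sets_into_space by blast+
  have "sym_diff (\<phi> k ` B) (\<phi> k ` C) = \<phi> k ` sym_diff B C"
    unfolding act_image[OF kG sub(1)] act_image[OF kG sub(2)] act_image[OF kG sub(3)] by blast
  then have "prob (sym_diff (\<phi> k ` B) (\<phi> k ` C)) < \<epsilon>"
    using act_image_sets(2)[OF kG sd] small by simp
  moreover have "determines M (name (lshift G k D)) (\<lambda>x. x \<in> \<phi> k ` C)"
    unfolding determines_def
  proof (intro ballI impI)
    fix x y assume xy: "x \<in> space M" "y \<in> space M" "name (lshift G k D) x = name (lshift G k D) y"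
    have "name D (\<phi> (inv k) x) = name D (\<phi> (inv k) y)"
      using name_lshift[OF kG cell xy(1,2)] xy(3) by blast
    moreover have "\<phi> (inv k) x \<in> space M" "\<phi> (inv k) y \<in> space M"
      using xy kG act_space by auto
    ultimately have "\<phi> (inv k) x \<in> C \<longleftrightarrow> \<phi> (inv k) y \<in> C"
      using det unfolding determines_def by blast
    then show "(x \<in> \<phi> k ` C) = (y \<in> \<phi> k ` C)" using xy by (simp add: act_image[OF kG sub(2)])
  qed
  moreover have "finite (lshift G k D)" "lshift G k D \<subseteq> K \<times> {l}"
    using D k subgroup.m_closed[OF K] by (auto simp: lshift_def)
  ultimately show "\<exists>D C. finite D \<and> D \<subseteq> K \<times> {l} \<and> C \<in> sets M \<and>
      determines M (name D) (\<lambda>x. x \<in> C) \<and> prob (sym_diff (\<phi> k ` B) C) < \<epsilon>"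
    using act_image_sets(1)[OF kG C] by (intro exI[of _ "lshift G k D"] exI[of _ "\<phi> k ` C"] conjI)
qed

text \<open>The approximable events form a \<open>K\<close>-invariant sigma-algebra containing the
  partition, hence contain the one it generates. The remaining null set does not affect the
  error.\<close>

lemma approximable_if_generating:
  assumes K: "subgroup K G" and gen: "generating_partition (G\<lparr>carrier := K\<rparr>) M \<phi> (P l)"
    and B: "B \<in> sets M"
  shows "approximable (K \<times> {l}) B"
proof -
  let ?\<A> = "{B. approximable (K \<times> {l}) B}"
  have "sigma_algebra (space M) ?\<A>"
    unfolding sigma_algebra_iff2
  proof (intro conjI ballI allI impI)
    show "?\<A> \<subseteq> Pow (space M)" using approximable_sets sets.sets_into_space by blast
    show "(\<Union>i. A i) \<in> ?\<A>" if "range A \<subseteq> ?\<A>" for A :: "nat \<Rightarrow> 'x set"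
      using that by (auto intro!: approximable_UN)
  qed (simp_all add: approximable_empty approximable_Compl)
  moreover have "P l \<subseteq> ?\<A>"
    using approximable_partition[of l "K \<times> {l}"] subgroup.one_closed[OF K] by blast
  moreover have "\<forall>k\<in>carrier (G\<lparr>carrier := K\<rparr>). \<forall>A\<in>?\<A>. \<phi> k ` A \<in> ?\<A>"
    using approximable_image[OF K] by simp
  ultimately have "invariant_sigma_algebra (G\<lparr>carrier := K\<rparr>) M \<phi> (P l) \<subseteq> ?\<A>"
    unfolding invariant_sigma_algebra_def by (intro Inter_lower) simp
  then obtain A where A: "approximable (K \<times> {l}) A" "sym_diff B A \<in> null_sets M"
    using gen B unfolding generating_partition_def by blast
  show ?thesis
  proof (rule approximableI[OF B])
    fix \<epsilon> :: real assume "0 < \<epsilon>"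
    with A(1) obtain D C where DC: "finite D" "D \<subseteq> K \<times> {l}" "C \<in> sets M"
      "determines M (name D) (\<lambda>x. x \<in> C)" and small: "prob (sym_diff A C) < \<epsilon>"
      by (rule approximableE)
    have sd: "sym_diff A C \<in> sets M" "sym_diff B A \<in> sets M"
      using approximable_sets[OF A(1)] B DC(3) by blast+
    have "sym_diff B C \<subseteq> sym_diff B A \<union> sym_diff A C" by blast
    then have "prob (sym_diff B C) \<le> prob (sym_diff B A \<union> sym_diff A C)"
      using sets.Un[OF sd(2,1)] by (rule finite_measure_mono)
    also have "\<dots> \<le> prob (sym_diff B A) + prob (sym_diff A C)"
      using sd by (intro measure_Un_le)
    also have "prob (sym_diff B A) = 0" using A(2) by (simp add: null_sets_def measure_def)
    finally have "prob (sym_diff B C) < \<epsilon>" using small by simp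
    then show "\<exists>D C. finite D \<and> D \<subseteq> K \<times> {l} \<and> C \<in> sets M \<and>
        determines M (name D) (\<lambda>x. x \<in> C) \<and> prob (sym_diff B C) < \<epsilon>"
      using DC by blast
  qed
qed

text \<open>Turns the generating property into the approximation hypotheses of
  \<open>euler_ball_family_le\<close>.\<close>

lemma h_insert_small:
  assumes K: "subgroup K G" and gen: "generating_partition (G\<lparr>carrier := K\<rparr>) M \<phi> (P l)"
    and i: "i \<in> carrier G \<times> UNIV" and \<epsilon>: "0 < \<epsilon>"
  shows "\<exists>D. finite D \<and> D \<subseteq> K \<times> {l} \<and> h (insert i D) \<le> h D + \<epsilon>"
proof -
  have KG: "K \<subseteq> carrier G" using K by (rule subgroup.subset)
  have cells: "D \<in> cells G" if "finite D" "D \<subseteq> K \<times> {l}" for D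
    using that KG by (auto simp: cells_def)
  have iG: "fst i \<in> carrier G" using i by auto
  obtain D where D: "finite D" "D \<subseteq> K \<times> {l}"
    "obs_entropy M (\<lambda>x. (coord i x, name D x)) \<le> obs_entropy M (name D) + ennreal \<epsilon>"
  proof (rule conditional_entropy_small[of "K \<times> {l}" name "coord i" \<epsilon>])
    show "\<exists>D C. finite D \<and> D \<subseteq> K \<times> {l} \<and> C \<in> sets M \<and>
        determines M (name D) (\<lambda>x. x \<in> C) \<and> prob (sym_diff B C) < \<delta>"
      if "B \<in> sets M" "0 < \<delta>" for B and \<delta> :: real
      using approximable_if_generating[OF K gen that(1)] that(2) unfolding approximable_def by blast
  qed (use observable_name[OF cells] observable_coord[OF iG] obs_entropy_coord[OF iG] \<epsilon>
      in \<open>simp_all add: determines_name\<close>)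
  have "obs_entropy M (\<lambda>x. (coord i x, name D x)) = obs_entropy M (name (insert i D))"
    by (rule obs_entropy_cong) (simp add: name_eq_iff)
  then have "ennreal (h (insert i D)) \<le> ennreal (h D + \<epsilon>)"
    using D cells[OF D(1,2)] iG \<epsilon> by (simp add: ennreal_h h_ge_0)
  then have "h (insert i D) \<le> h D + \<epsilon>"
    by (subst (asm) ennreal_le_iff) (use \<epsilon> in \<open>simp_all add: h_ge_0\<close>)
  then show ?thesis using D by blast
qed

section \<open>Identification of \<open>F_entropy\<close> with the expression in
  \<open>h\<close>\<close>

lemma translate_fibres:
  assumes g: "g \<in> carrier G"
  shows "translate \<phi> g (fibre M V ` space M) = fibre M (\<lambda>x. V (\<phi> (inv g) x)) ` space M"
proof -
  have "\<phi> g ` fibre M V x = fibre M (\<lambda>x. V (\<phi> (inv g) x)) (\<phi> g x)" if "x \<in> space M" for x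
    using that g by (subst act_image) (auto simp: fibre_def act_space)
  then have "translate \<phi> g (fibre M V ` space M) = (\<lambda>x. fibre M (\<lambda>x. V (\<phi> (inv g) x)) (\<phi> g x)) ` space M"
    unfolding translate_def image_image by (rule image_cong[OF refl])
  also have "\<dots> = fibre M (\<lambda>x. V (\<phi> (inv g) x)) ` \<phi> g ` space M"
    by (simp add: image_image)
  finally show ?thesis using group_action.surj_prop[OF act g] by simp
qed

lemma shannon_entropy_name:
  assumes D: "D \<in> cells G"
  shows "shannon_entropy M (fibre M (name D) ` space M) = ereal (h D)"
proof -
  have "shannon_entropy M (fibre M (name D) ` space M) = enn2ereal (obs_entropy M (name D))"
    using observable_name[OF D] by (intro shannon_entropy_fibres) simp
  also have "\<dots> = enn2ereal (ennreal (h D))" by (simp only: ennreal_h[OF D])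
  also have "\<dots> = ereal (h D)" by (rule enn2ereal_ennreal[OF h_ge_0])
  finally show ?thesis .
qed

lemma translate_join_P:
  assumes B: "B \<noteq> {}" "B \<subseteq> carrier G"
  shows "translate_join \<phi> B (P l) = fibre M (name (B \<times> {l})) ` space M"
proof -
  have "(\<lambda>g. translate \<phi> g (P l)) ` B = (\<lambda>g. fibre M (\<lambda>x. block (P l) (\<phi> (inv g) x)) ` space M) ` B"
    using translate_fibres[of _ "block (P l)"] fibre_block_image[OF partition_P, of l] B
    by (intro image_cong) (auto simp: subset_iff)
  moreover have "common_refinement ((\<lambda>g. fibre M (\<lambda>x. block (P l) (\<phi> (inv g) x)) ` space M) ` B)
      = fibre M (name (B \<times> {l})) ` space M"
    using B by (intro common_refinement_fibres) (auto simp: name_eq_iff coord_def)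
  ultimately show ?thesis by (simp add: translate_join_def)
qed

lemma F_entropy_translate_join:
  assumes B: "B \<noteq> {}" "B \<subseteq> carrier G" "finite B" and S: "S \<subseteq> carrier G"
  shows "F_entropy M \<phi> S (translate_join \<phi> B (P l)) =
    ereal ((1 - 2 * real (card S)) * h (B \<times> {l}) +
      (\<Sum>s\<in>S. h (lshift G s (B \<times> {l}) \<union> B \<times> {l})))"
proof -
  let ?B = "B \<times> {l}"
  have cells: "?B \<in> cells G" using B by (auto simp: cells_def)
  have "shannon_entropy M (common_refinement {translate \<phi> s (fibre M (name ?B) ` space M), fibre M (name ?B) ` space M})
      = ereal (h (lshift G s ?B \<union> ?B))" if "s \<in> S" for s
  proof -
    have s: "s \<in> carrier G" using that S by auto
    \<comment> \<open>The pair of partitions is indexed by \<open>bool\<close> to fit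
      \<open>common_refinement_fibres\<close>.\<close>
    let ?V = "\<lambda>b. if b then (\<lambda>x. name ?B (\<phi> (inv s) x)) else name ?B"
    have "{translate \<phi> s (fibre M (name ?B) ` space M), fibre M (name ?B) ` space M}
        = (\<lambda>b. fibre M (?V b) ` space M) ` UNIV"
      by (simp add: UNIV_bool translate_fibres[OF s] insert_commute)
    moreover have "common_refinement \<dots> = fibre M (name (lshift G s ?B \<union> ?B)) ` space M"
    proof (rule common_refinement_fibres)
      fix x y assume "x \<in> space M" "y \<in> space M"
      then have "name (lshift G s ?B) x = name (lshift G s ?B) y \<longleftrightarrow>
          name ?B (\<phi> (inv s) x) = name ?B (\<phi> (inv s) y)"
        by (rule name_lshift[OF s cells])
      moreover have "name (lshift G s ?B \<union> ?B) x = name (lshift G s ?B \<union> ?B) y \<longleftrightarrow>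
          name (lshift G s ?B) x = name (lshift G s ?B) y \<and> name ?B x = name ?B y"
        by (auto simp: name_eq_iff)
      ultimately show "name (lshift G s ?B \<union> ?B) x = name (lshift G s ?B \<union> ?B) y \<longleftrightarrow>
          (\<forall>b\<in>UNIV. ?V b x = ?V b y)"
        by auto
    qed simp
    ultimately show ?thesis using shannon_entropy_name[of "lshift G s ?B \<union> ?B"] s cells by simp
  qed
  then show ?thesis
    using shannon_entropy_name[OF cells] by (simp add: F_entropy_def translate_join_P[OF B(1,2)])
qed

end

section \<open>The upper bound for f-invariant entropy\<close>

text \<open>Invariance under a larger set of group elements is harder to satisfy, so fewer
  sigma-algebras are intersected and the result is larger.\<close>

lemma generating_partition_mono:
  assumes "generating_partition (G\<lparr>carrier := H\<rparr>) M \<phi> \<alpha>" "H \<subseteq> K"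
  shows "generating_partition (G\<lparr>carrier := K\<rparr>) M \<phi> \<alpha>"
proof -
  have "invariant_sigma_algebra (G\<lparr>carrier := H\<rparr>) M \<phi> \<alpha> \<subseteq> invariant_sigma_algebra (G\<lparr>carrier := K\<rparr>) M \<phi> \<alpha>"
    using assms(2) unfolding invariant_sigma_algebra_def by (intro Inter_anti_mono) auto
  then show ?thesis using assms(1) unfolding generating_partition_def by blast
qed

lemma free_generating_set_nonempty:
  assumes "group G" "free_generating_set G S" "x \<in> carrier G" "x \<noteq> \<one>\<^bsub>G\<^esub>"
  shows "S \<noteq> {}"
proof
  assume "S = {}"
  then have "{w \<in> words_over S. reduced w} \<subseteq> {[]}" by (auto simp: words_over_def)
  moreover have "x \<in> eval_word G ` {w \<in> words_over S. reduced w}"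
    using assms by (simp add: free_generating_set_def bij_betw_def)
  ultimately show False using assms by (auto simp: eval_word_def)
qed

theorem corollary1p2:
  fixes G :: "('g, 'b) monoid_scheme"
    and H :: "'g set"
    and M :: "'x measure"
    and \<phi> :: "'g \<Rightarrow> 'x \<Rightarrow> 'x"
  assumes "fg_free_group G"
    and "subgroup H G"
    and "H \<noteq> {\<one>\<^bsub>G\<^esub>}"
    and "infinite (rcosets\<^bsub>G\<^esub> H)"
    and "standard_prob_space M"
    and "pmp_action G M \<phi>"
    and "infinite {K. subgroup K G \<and> finite (rcosets\<^bsub>G\<^esub> K) \<and> H \<subseteq> K}"
    and "f_defined (G\<lparr>carrier := H\<rparr>) M \<phi>"
  shows "f_defined G M \<phi> \<and> f_entropy G M \<phi> \<le> 0"
proof -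
  interpret group G using assms(1) by (simp add: fg_free_group_def)
  obtain \<alpha> where gen_H: "generating_partition (G\<lparr>carrier := H\<rparr>) M \<phi> \<alpha>" and fin_\<alpha>: "shannon_entropy M \<alpha> < \<infinity>"
    using assms(8) by (auto simp: f_defined_def)
  have "generating_partition (G\<lparr>carrier := carrier G\<rparr>) M \<phi> \<alpha>"
    using gen_H subgroup.subset[OF assms(2)] by (rule generating_partition_mono)
  then have defined: "f_defined G M \<phi>" using assms(1) fin_\<alpha> by (auto simp: f_defined_def)
  \<comment> \<open>This is the pair at which \<open>f_entropy\<close> is evaluated; its partition
    may be unrelated to \<alpha>.\<close>
  define S\<beta> where "S\<beta> = (SOME (S, \<beta>). f_data G M \<phi> S \<beta>)"
  obtain S \<beta> where S\<beta>: "S\<beta> = (S, \<beta>)" by (cases S\<beta>)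
  have "\<exists>p. case p of (S, \<beta>) \<Rightarrow> f_data G M \<phi> S \<beta>"
    using defined by (auto simp: f_defined_def f_data_def fg_free_group_def)
  then have "case S\<beta> of (S, \<beta>) \<Rightarrow> f_data G M \<phi> S \<beta>"
    unfolding S\<beta>_def by (rule someI_ex)
  then have S: "finite S" "free_generating_set G S" and gen_\<beta>: "generating_partition G M \<phi> \<beta>"
    and fin_\<beta>: "shannon_entropy M \<beta> < \<infinity>" by (auto simp: S\<beta> f_data_def)
  have SG: "S \<subseteq> carrier G" using S by (simp add: free_generating_set_def)
  obtain x where "x \<in> H" "x \<noteq> \<one>\<^bsub>G\<^esub>" using assms(3) subgroup.one_closed[OF assms(2)] by blast
  then have S_ne: "S \<noteq> {}"
    using free_generating_set_nonempty[OF _ S(2)] subgroup.mem_carrier[OF assms(2)] is_group by blast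
  \<comment> \<open>From here on label \<open>True\<close> refers to \<alpha> and label
    \<open>False\<close> to \<beta>.\<close>
  let ?P = "\<lambda>b. if b then \<alpha> else \<beta>"
  interpret partitioned_action M G \<phi> ?P
    using assms(5,6) gen_H gen_\<beta> fin_\<alpha> fin_\<beta> is_group
    by (auto simp: partitioned_action_def partitioned_action_axioms_def standard_prob_space_def
        generating_partition_def)
  let ?B = "word_ball G S"
  define F where "F n = (1 - 2 * real (card S)) * h (?B n \<times> {False}) +
    (\<Sum>s\<in>S. h (lshift G s (?B n \<times> {False}) \<union> ?B n \<times> {False}))" for n
  have F: "F_entropy M \<phi> S (translate_join \<phi> (?B n) \<beta>) = ereal (F n)" for n
    using F_entropy_translate_join[of "?B n" S False] one_in_word_ball[of S n]
      word_ball_carrier[OF SG, of n] finite_word_ball[OF S(1), of n] SG by (auto simp: F_def)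
  \<comment> \<open>The monotonicity of \<open>F\<close> does not involve \<epsilon>, but it too is
    read off from the orbit sums of the subgroup \<open>K\<close> chosen below.\<close>
  have small: "\<exists>m. F m \<le> \<epsilon>" and mono: "decseq F" if \<epsilon>: "0 < \<epsilon>" for \<epsilon>
  proof -
    \<comment> \<open>The index of \<open>K\<close> must exceed
      \<open>(h {(\<one>, True)} + 1) / \<epsilon>\<close>, with \<open>h {(\<one>, True)}\<close>
      the entropy of \<alpha>; the summand 1 is the error allowed in
      \<open>euler_ball_family_le\<close>.\<close>
    obtain N :: nat where N: "(h {(\<one>\<^bsub>G\<^esub>, True)} + 1) / \<epsilon> < real N" using reals_Archimedean2 by blast
    obtain K where KH: "subgroup K G" "finite (rcosets\<^bsub>G\<^esub> K)" "H \<subseteq> K" "N < card (rcosets\<^bsub>G\<^esub> K)"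
      using index_unbounded[OF assms(7)] by blast
    interpret equivariant_families G h K S
      by (intro equivariant_families.intro submodular_entropy_axioms equivariant_families_axioms.intro
          KH(1,2) S(1) SG)
    have euler: "euler (ball_family False (carrier G) n) = real (card (rcosets\<^bsub>G\<^esub> K)) * F n" for n
      by (simp add: euler_ball_family_carrier F_def)
    have pos: "0 < real (card (rcosets\<^bsub>G\<^esub> K))" using KH(4) by linarith
    have "F (Suc n) \<le> F n" for n
      using euler_ball_family_Suc[OF equivariant_empty equivariant_ball_family_carrier, of False n] pos
      by (simp add: euler)
    then show "decseq F" by (rule decseq_SucI)
    have gen_K: "generating_partition (G\<lparr>carrier := K\<rparr>) M \<phi> (?P True)"
      using generating_partition_mono[OF gen_H KH(3)] by simp
    have gen_G: "generating_partition (G\<lparr>carrier := carrier G\<rparr>) M \<phi> (?P False)"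
      using gen_\<beta> by simp
    have exhaust: "\<exists>n. x \<in> word_ball G S n" if "x \<in> carrier G" for x
      by (rule word_balls_exhaust[OF S(2) that]) (rule exI)
    obtain m where "euler (ball_family False (carrier G) m) \<le> h {(\<one>\<^bsub>G\<^esub>, True)} + 1"
      by (rule euler_ball_family_le[OF exhaust S_ne h_insert_small[OF KH(1) gen_K]
            h_insert_small[OF subgroup_self gen_G] zero_less_one])
    then have "real (card (rcosets\<^bsub>G\<^esub> K)) * F m \<le> h {(\<one>\<^bsub>G\<^esub>, True)} + 1" by (simp add: euler)
    also have "\<dots> \<le> real (card (rcosets\<^bsub>G\<^esub> K)) * \<epsilon>"
    proof -
      have "h {(\<one>\<^bsub>G\<^esub>, True)} + 1 \<le> real N * \<epsilon>" using N \<epsilon> by (simp add: field_simps)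
      also have "\<dots> \<le> real (card (rcosets\<^bsub>G\<^esub> K)) * \<epsilon>" using KH(4) \<epsilon> by (intro mult_right_mono) auto
      finally show ?thesis .
    qed
    finally show "\<exists>m. F m \<le> \<epsilon>" using pos by auto
  qed
  have "decseq (\<lambda>n. ereal (F n))" using mono[of 1] by (simp add: decseq_def)
  \<comment> \<open>Monotonicity identifies the limit defining \<open>f_entropy\<close> with the
    infimum, so for each positive \<epsilon> a single good radius suffices.\<close>
  then have lim: "(\<lambda>n. ereal (F n)) \<longlonglongrightarrow> (INF n. ereal (F n))" by (rule LIMSEQ_INF)
  have "(INF n. ereal (F n)) \<le> 0"
  proof (rule ereal_le_epsilon2)
    fix \<epsilon> :: real assume "0 < \<epsilon>"
    then obtain m where "F m \<le> \<epsilon>" using small by blast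
    then have "(INF n. ereal (F n)) \<le> ereal \<epsilon>" by (intro INF_lower2[of m]) auto
    then show "(INF n. ereal (F n)) \<le> 0 + ereal \<epsilon>" by simp
  qed
  moreover have "f_entropy G M \<phi> = (INF n. ereal (F n))"
    unfolding f_entropy_def S\<beta>_def[symmetric] S\<beta> by (simp add: F limI[OF lim])
  ultimately show ?thesis using defined by simp
qed

end
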